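(* Let $K\subset\mathbb{R}$ be compact, let $r,l\ge 0$ and $m\geq 1$ be integers, and let $n=r+2l\ge 1$. Let $\lambda_1,\dots,\lambda_r,\alpha_1,\dots,\alpha_l,\omega_1,\dots,\omega_l\in C(K,\mathbb{R})$ be such that each of the functions $\lambda_j$ ($1\le j\le r$) and $\alpha_j\pm i\omega_j$ ($1\le j\le l$) is finite-to-one. Put $$A(\beta)=\operatorname{diag}\{\lambda_1(\beta),\dots,\lambda_r(\beta),G_1(\beta),\dots,G_l(\beta)\}\in\mathbb{R}^{n\times n},\qquad G_j(\beta)=\begin{bmatrix}\alpha_j(\beta)&-\omega_j(\beta)\\ \omega_j(\beta)&\alpha_j(\beta)\end{bmatrix},$$ $$A^{\ast}(\beta)=\operatorname{diag}\{\lambda_1(\beta),\dots,\lambda_r(\beta),G_1^{\ast}(\beta),\dots,G_l^{\ast}(\beta)\},\qquad G_j^{\ast}(\beta)=\begin{bmatrix}\alpha_j(\beta)&\omega_j(\beta)\\ -\omega_j(\beta)&\alpha_j(\beta)\end{bmatrix},$$ and let $B=[b_1,\dots,b_m]\in C(K,\mathbb{R}^{n\times m})$ with columns $b_1,\dots,b_m\in C(K,\mathbb{R}^n)$. Suppose that $$\mathcal{L}=\mathrm{span}_{\mathbb{R}}\{A^kb_j: 1\le j\le m,\ k\in\mathbb{N}\}\subset C(K,\mathbb{R}^n)$$ satisfies $A^{\ast}(\cdot)f(\cdot)\in\mathcal{L}$ for every $f\in\mathcal{L}$. Then the linear ensemble $$\frac{\mathrm{d}}{\mathrm{d}t}X(t,\beta)=A(\beta)X(t,\beta)+\sum_{j=1}^m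 b_j(\beta)u_j(t),\qquad \beta\in K,$$ with state $X(t,\cdot)\in C(K,\mathbb{R}^n)$ and piecewise constant controls $u=(u_1,\dots,u_m):[0,T]\to\mathbb{R}^m$, is uniformly ensemble controllable on $C(K,\mathbb{R}^n)$ if and only if for every $\eta\in\mathcal{K}$ the ensemble controllability matrix $$G(\eta)=\begin{bmatrix}B(\beta_1)&A(\beta_1)B(\beta_1)&\cdots&A^{n\kappa(\eta)-1}(\beta_1)B(\beta_1)\\ \vdots&\vdots&&\vdots\\ B(\beta_{\kappa(\eta)})&A(\beta_{\kappa(\eta)})B(\beta_{\kappa(\eta)})&\cdots&A^{n\kappa(\eta)-1}(\beta_{\kappa(\eta)})B(\beta_{\kappa(\eta)})\end{bmatrix}\in\mathbb{R}^{n\kappa(\eta)\times mn\kappa(\eta)},$$ where $\gamma^{-1}(\eta)=\{\beta_1,\dots,\beta_{\kappa(\eta)}\}$, has full row rank, i.e. $\operatorname{rank}G(\eta)=n\kappa(\eta)$.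
   Context: $\mathbb{N}=\{0,1,2,\dots\}$. $C(S,E)$ denotes the space of continuous $E$-valued functions on $S$. A function $\lambda$ on $K$ is finite-to-one if $\lambda^{-1}(\eta)$ is finite for every $\eta\in\lambda(K)$. Uniform ensemble controllability on $C(K,\mathbb{R}^n)$: for every $\epsilon>0$, every initial state $X_0\in C(K,\mathbb{R}^n)$ and every target $X_F\in C(K,\mathbb{R}^n)$, there exist a finite time $T>0$ and a piecewise constant control $u:[0,T]\to\mathbb{R}^m$ (the same $u$ for all $\beta\in K$) such that the solution with $X(0,\cdot)=X_0$ satisfies $\sup_{\beta\in K}\|X(T,\beta)-X_F(\beta)\|<\epsilon$, where $\|\cdot\|$ is any norm on $\mathbb{R}^n$. Set of eigenvalues: $\mathcal{K}=\bigcup_{j=1}^r\lambda_j(K)\cup\bigcup_{j=1}^l(\alpha_j+i\omega_j)(K)\cup\bigcup_{j=1}^l(\alpha_j-i\omega_j)(K)\subset\mathbb{C}$. For $\eta\in\mathcal{K}$, $\gamma^{-1}(\eta)=\bigcup_{j=1}^r\lambda_j^{-1}(\eta)\cup\bigcup_{j=1}^l(\alpha_j+i\omega_j)^{-1}(\eta)\cup\bigcup_{j=1}^l(\alpha_j-i\omega_j)^{-1}(\eta)\subset K$ (a union of preimages of $\eta$; a finite set), and $\kappa(\eta)$ is the cardinality of $\gamma^{-1}(\eta)$; its elements are enumerated as distinct points $\beta_1,\dots,\beta_{\kappa(\eta)}$. *)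

theory Defs
  imports
    "HOL-Library.Extended_Nonnegative_Real"
    "Jordan_Normal_Form.DL_Rank"
begin

text \<open>
  Families indexed by \<open>1, \<dots>, r\<close> are functions on \<open>nat\<close> of which only the values at indices below \<open>r\<close>
  matter, so all indices are shifted down by one. A function on \<open>K\<close> is a total function on \<open>real\<close>
  of which only the values on \<open>K\<close> matter.
\<close>

definition finite_to_one_on :: "'a set \<Rightarrow> ('a \<Rightarrow> 'b) \<Rightarrow> bool" where
  "finite_to_one_on K f \<longleftrightarrow> (\<forall>\<eta>\<in>f ` K. finite (f -` {\<eta>} \<inter> K))"

definition cont_vec_fun :: "real set \<Rightarrow> nat \<Rightarrow> (real \<Rightarrow> real vec) set" where
  "cont_vec_fun K n = {f. (\<forall>\<beta>\<in>K. f \<beta> \<in> carrier_vec n) \<and>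
                          (\<forall>i<n. continuous_on K (\<lambda>\<beta>. f \<beta> $ i))}"

definition vec_norm_on :: "nat \<Rightarrow> (real vec \<Rightarrow> real) \<Rightarrow> bool" where
  "vec_norm_on n N \<longleftrightarrow>
     (\<forall>v\<in>carrier_vec n. 0 \<le> N v \<and> (N v = 0 \<longleftrightarrow> v = 0\<^sub>v n)) \<and>
     (\<forall>v\<in>carrier_vec n. \<forall>c. N (c \<cdot>\<^sub>v v) = \<bar>c\<bar> * N v) \<and>
     (\<forall>v\<in>carrier_vec n. \<forall>w\<in>carrier_vec n. N (v + w) \<le> N v + N w)"

definition rot_block :: "real \<Rightarrow> real \<Rightarrow> real mat" where
  "rot_block a w = mat_of_rows_list 2 [[a, - w], [w, a]]"

definition rot_block_adj :: "real \<Rightarrow> real \<Rightarrow> real mat" where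
  "rot_block_adj a w = mat_of_rows_list 2 [[a, w], [- w, a]]"

definition sys_mat ::
  "nat \<Rightarrow> nat \<Rightarrow> (nat \<Rightarrow> real \<Rightarrow> real) \<Rightarrow> (nat \<Rightarrow> real \<Rightarrow> real) \<Rightarrow> (nat \<Rightarrow> real \<Rightarrow> real) \<Rightarrow> real \<Rightarrow> real mat" where
  "sys_mat r l lam \<alpha> \<omega> \<beta> = diag_block_mat
     (map (\<lambda>j. mat 1 1 (\<lambda>_. lam j \<beta>)) [0..<r] @ map (\<lambda>j. rot_block (\<alpha> j \<beta>) (\<omega> j \<beta>)) [0..<l])"

definition sys_mat_adj ::
  "nat \<Rightarrow> nat \<Rightarrow> (nat \<Rightarrow> real \<Rightarrow> real) \<Rightarrow> (nat \<Rightarrow> real \<Rightarrow> real) \<Rightarrow> (nat \<Rightarrow> real \<Rightarrow> real) \<Rightarrow> real \<Rightarrow> real mat" where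
  "sys_mat_adj r l lam \<alpha> \<omega> \<beta> = diag_block_mat
     (map (\<lambda>j. mat 1 1 (\<lambda>_. lam j \<beta>)) [0..<r] @ map (\<lambda>j. rot_block_adj (\<alpha> j \<beta>) (\<omega> j \<beta>)) [0..<l])"

definition input_mat :: "nat \<Rightarrow> nat \<Rightarrow> (nat \<Rightarrow> real \<Rightarrow> real vec) \<Rightarrow> real \<Rightarrow> real mat" where
  "input_mat n m b \<beta> = mat_of_cols n (map (\<lambda>j. b j \<beta>) [0..<m])"

definition fun_span :: "real set \<Rightarrow> nat \<Rightarrow> (real \<Rightarrow> real vec) set \<Rightarrow> (real \<Rightarrow> real vec) set" where
  "fun_span K n S = {f. \<exists>F c. finite F \<and> F \<subseteq> S \<and>
                         (\<forall>\<beta>\<in>K. f \<beta> = vec n (\<lambda>i. \<Sum>g\<in>F. c g * g \<beta> $ i))}"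

definition control_span ::
  "real set \<Rightarrow> nat \<Rightarrow> nat \<Rightarrow> (real \<Rightarrow> real mat) \<Rightarrow> (nat \<Rightarrow> real \<Rightarrow> real vec) \<Rightarrow> (real \<Rightarrow> real vec) set" where
  "control_span K n m A b = fun_span K n {\<lambda>\<beta>. (A \<beta> ^\<^sub>m k) *\<^sub>v b j \<beta> | k j. j < m}"

definition piecewise_const_control :: "nat \<Rightarrow> real \<Rightarrow> (real \<Rightarrow> real vec) \<Rightarrow> bool" where
  "piecewise_const_control m T u \<longleftrightarrow>
     (\<forall>t\<in>{0..T}. u t \<in> carrier_vec m) \<and>
     (\<exists>p s. s 0 = 0 \<and> s p = T \<and>
        (\<forall>i<p. s i < s (Suc i) \<and> (\<exists>c. \<forall>t\<in>{s i<..<s (Suc i)}. u t = c)))"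

text \<open>
  Controls jump at finitely many times, and there the differential equation need not hold.
  Continuity in time determines the solution across these exceptional times.
\<close>

definition ensemble_solution ::
  "real set \<Rightarrow> nat \<Rightarrow> nat \<Rightarrow> (real \<Rightarrow> real mat) \<Rightarrow> (nat \<Rightarrow> real \<Rightarrow> real vec) \<Rightarrow>
   real \<Rightarrow> (real \<Rightarrow> real vec) \<Rightarrow> (real \<Rightarrow> real \<Rightarrow> real vec) \<Rightarrow> bool" where
  "ensemble_solution K n m A b T u X \<longleftrightarrow>
     (\<forall>t\<in>{0..T}. X t \<in> cont_vec_fun K n) \<and>
     (\<forall>\<beta>\<in>K. \<forall>i<n. continuous_on {0..T} (\<lambda>t. X t \<beta> $ i)) \<and>
     (\<exists>D. finite D \<and> (\<forall>t\<in>{0..T} - D. \<forall>\<beta>\<in>K. \<forall>i<n.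
        ((\<lambda>s. X s \<beta> $ i) has_real_derivative
           (A \<beta> *\<^sub>v X t \<beta>) $ i + (\<Sum>j<m. b j \<beta> $ i * u t $ j)) (at t within {0..T})))"

text \<open>
  The supremum is taken in \<open>[0,\<infinity>]\<close>, which makes it \<open>0\<close> for empty \<open>K\<close>.
\<close>

definition uniformly_ensemble_controllable ::
  "(real vec \<Rightarrow> real) \<Rightarrow> real set \<Rightarrow> nat \<Rightarrow> nat \<Rightarrow> (real \<Rightarrow> real mat) \<Rightarrow> (nat \<Rightarrow> real \<Rightarrow> real vec) \<Rightarrow> bool" where
  "uniformly_ensemble_controllable N K n m A b \<longleftrightarrow>
     (\<forall>\<epsilon>>0. \<forall>X0\<in>cont_vec_fun K n. \<forall>XF\<in>cont_vec_fun K n.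
        \<exists>T>0. \<exists>u X. piecewise_const_control m T u \<and>
          ensemble_solution K n m A b T u X \<and>
          (\<forall>\<beta>\<in>K. X 0 \<beta> = X0 \<beta>) \<and>
          (SUP \<beta>\<in>K. ennreal (N (X T \<beta> - XF \<beta>))) < ennreal \<epsilon>)"

definition eigenvalue_set ::
  "real set \<Rightarrow> nat \<Rightarrow> nat \<Rightarrow> (nat \<Rightarrow> real \<Rightarrow> real) \<Rightarrow> (nat \<Rightarrow> real \<Rightarrow> real) \<Rightarrow> (nat \<Rightarrow> real \<Rightarrow> real) \<Rightarrow> complex set" where
  "eigenvalue_set K r l lam \<alpha> \<omega> =
     (\<Union>j<r. (\<lambda>\<beta>. complex_of_real (lam j \<beta>)) ` K) \<union>
     (\<Union>j<l. (\<lambda>\<beta>. Complex (\<alpha> j \<beta>) (\<omega> j \<beta>)) ` K) \<union>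
     (\<Union>j<l. (\<lambda>\<beta>. Complex (\<alpha> j \<beta>) (- \<omega> j \<beta>)) ` K)"

definition eigenvalue_fiber ::
  "real set \<Rightarrow> nat \<Rightarrow> nat \<Rightarrow> (nat \<Rightarrow> real \<Rightarrow> real) \<Rightarrow> (nat \<Rightarrow> real \<Rightarrow> real) \<Rightarrow> (nat \<Rightarrow> real \<Rightarrow> real) \<Rightarrow>
   complex \<Rightarrow> real set" where
  "eigenvalue_fiber K r l lam \<alpha> \<omega> \<eta> =
     (\<Union>j<r. (\<lambda>\<beta>. complex_of_real (lam j \<beta>)) -` {\<eta>} \<inter> K) \<union>
     (\<Union>j<l. (\<lambda>\<beta>. Complex (\<alpha> j \<beta>) (\<omega> j \<beta>)) -` {\<eta>} \<inter> K) \<union>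
     (\<Union>j<l. (\<lambda>\<beta>. Complex (\<alpha> j \<beta>) (- \<omega> j \<beta>)) -` {\<eta>} \<inter> K)"

text \<open>
  For a list of points \<open>\<beta>\<^sub>1, \<dots>, \<beta>\<^sub>\<kappa>\<close>, the block matrix with \<open>n\<close>-by-\<open>m\<close> blocks \<open>A\<^sup>k(\<beta>\<^sub>p) B(\<beta>\<^sub>p)\<close>
  in block row \<open>p\<close> and block column \<open>k < n\<kappa>\<close>.
\<close>

definition ensemble_controllability_matrix ::
  "nat \<Rightarrow> nat \<Rightarrow> (real \<Rightarrow> real mat) \<Rightarrow> (real \<Rightarrow> real mat) \<Rightarrow> real list \<Rightarrow> real mat" where
  "ensemble_controllability_matrix n m A B \<beta>s =
     mat (n * length \<beta>s) (m * n * length \<beta>s)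
       (\<lambda>(i, c). (A (\<beta>s ! (i div n)) ^\<^sub>m (c div m) * B (\<beta>s ! (i div n))) $$ (i mod n, c mod m))"

end

theory Submission
  imports "HOL-Analysis.Analysis" Defs
begin

text \<open>
  Pairing the two coordinates of each rotation block into a complex number turns \<open>A(\<beta>)\<close> into a diagonal
  matrix with entries \<open>z\<^sub>i(\<beta>)\<close>, the eigenvalues. Since \<open>\<L>\<close> is invariant under \<open>A\<close> and \<open>A\<^sup>*\<close>, it is
  invariant under multiplication of the coordinates by polynomials in \<open>Re z\<^sub>i\<close> and \<open>(Im z\<^sub>i)\<^sup>2\<close>. By a
  Stone-Weierstrass argument for modules, \<open>\<L>\<close> is dense as soon as its restriction to each fibre of
  \<open>(Re z\<^sub>i, (Im z\<^sub>i)\<^sup>2)\<close> is everything; such a fibre lives over the points of one \<open>\<gamma>\<^sup>-\<^sup>1(\<eta>)\<close>, where the rank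
  condition provides arbitrary values. Density of \<open>\<L>\<close> gives controllability in time \<open>1\<close>: the responses to step
  inputs acting during the last \<open>s\<close> time units span a space whose closure contains all \<open>A\<^sup>k b\<^sub>j\<close>, as letting
  \<open>s \<rightarrow> 0\<close> shows. Conversely, a vector annihilating the columns of \<open>G(\<eta>)\<close> annihilates all \<open>A\<^sup>k b\<^sub>j\<close> at the points
  of \<open>\<gamma>\<^sup>-\<^sup>1(\<eta>)\<close>, hence every state reachable from \<open>0\<close>.
\<close>

hide_const (open) Finite_Cartesian_Product.vec Determinants.det
hide_type (open) Finite_Cartesian_Product.vec
unbundle no vec_syntax

section \<open>Rank and norms on coordinate vectors\<close>

text \<open>Powers of \<open>A\<close> alone give polynomials in the complex eigenvalue, and these
  need not be dense on a planar set such as a circle. The adjoint makes real and imaginary parts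
  available separately. Multiplication by the imaginary part, however, also exchanges the two
  coordinates of a rotation block, with opposite signs, so only its square acts on each coordinate
  separately. The price is that \<eta> and its conjugate are not told apart; this is harmless,
  because both have the same set of points. The number of powers in the controllability matrix is
  the number of pairs of a point and a coordinate over the fibre: each pair contributes one root to
  the polynomial that generates all higher powers. After pairing, every coordinate obeys a scalar
  equation \<open>x' = z x + input\<close>, so both directions work with scalar exponentials and no
  matrix exponential occurs.\<close>

lemma rank_eq_nrows_iff_surj:
  fixes G :: "real mat"
  assumes G: "G \<in> carrier_mat nr nc"
  shows "vec_space.rank nr G = nr \<longleftrightarrow> (\<forall>v\<in>carrier_vec nr. \<exists>x\<in>carrier_vec nc. G *\<^sub>v x = v)"
proof -
  interpret vec_space "TYPE(real)" nr .
  have col: "col_space G = {y \<in> carrier_vec nr. \<exists>x\<in>carrier_vec nc. G *\<^sub>v x = y}"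
    using col_space_eq[OF G] G by auto
  have cs: "set (cols G) \<subseteq> carrier V"
    using cols_dim[of G] G by auto
  show ?thesis
  proof
    assume rk: "rank G = nr"
    obtain S where S: "maximal S (\<lambda>T. T \<subseteq> set (cols G) \<and> lin_indpt T)"
      using maximal_exists[of "(\<lambda>T. T \<subseteq> set (cols G) \<and> lin_indpt T)" "card (set (cols G))" "{}"]
      by (meson List.finite_set card_mono empty_iff empty_subsetI finite_lin_indpt2 rev_finite_subset)
    \<comment> \<open>The rank counts a maximal independent set of columns; \<open>nr\<close>
      independent vectors in dimension \<open>nr\<close> form a basis, so the columns span.\<close>
    have "card S = nr" using rank_card_indpt[OF G S] rk by simp
    moreover have sub: "S \<subseteq> set (cols G)" and li: "lin_indpt S" using S by (auto simp: maximal_def)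
    moreover have "finite S" using sub finite_subset by blast
    ultimately have "basis S"
      using dim_li_is_basis[of S] cs dim_is_n fin_dim by auto
    then have "span S = carrier V" by (auto simp: basis_def)
    then have "carrier V \<subseteq> span (set (cols G))" using span_is_monotone[OF sub] by simp
    then have "carrier_vec nr \<subseteq> col_space G" by (simp add: col_space_def)
    then show "\<forall>v\<in>carrier_vec nr. \<exists>x\<in>carrier_vec nc. G *\<^sub>v x = v" unfolding col by blast
  next
    assume "\<forall>v\<in>carrier_vec nr. \<exists>x\<in>carrier_vec nc. G *\<^sub>v x = v"
    then have "col_space G = carrier_vec nr" unfolding col by auto
    then have "span (set (cols G)) = carrier V" by (simp add: col_space_def)
    then have "vs (span (set (cols G))) = V" by simp
    then show "rank G = nr" unfolding rank_def using dim_is_n by simp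
  qed
qed

text \<open>If no nonzero \<open>w\<close> is annihilated by \<open>G\<^sup>T\<close>, the Gram matrix \<open>G G\<^sup>T\<close> is invertible, which
  produces preimages under \<open>G\<close>.\<close>
lemma not_surj_imp_left_kernel:
  fixes G :: "real mat"
  assumes G: "G \<in> carrier_mat nr nc"
    and "\<not> (\<forall>v\<in>carrier_vec nr. \<exists>x\<in>carrier_vec nc. G *\<^sub>v x = v)"
  obtains w where "w \<in> carrier_vec nr" "w \<noteq> 0\<^sub>v nr" "G\<^sup>T *\<^sub>v w = 0\<^sub>v nc"
proof -
  have GT: "G\<^sup>T \<in> carrier_mat nc nr" using G by simp
  define M where "M = G * G\<^sup>T"
  have M: "M \<in> carrier_mat nr nr" using G by (simp add: M_def)
  have "\<exists>w\<in>carrier_vec nr. w \<noteq> 0\<^sub>v nr \<and> M *\<^sub>v w = 0\<^sub>v nr"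
  proof (rule ccontr)
    assume "\<not> ?thesis"
    then have "det M \<noteq> 0"
      unfolding det_0_iff_vec_prod_zero_field[OF M] by (simp add: Bex_def)
    then obtain M' where M': "M' \<in> carrier_mat nr nr" "M * M' = 1\<^sub>m nr"
      using det_non_zero_imp_unit[OF M] M by (auto simp: Units_def ring_mat_def)
    have "G *\<^sub>v (G\<^sup>T *\<^sub>v (M' *\<^sub>v v)) = v \<and> G\<^sup>T *\<^sub>v (M' *\<^sub>v v) \<in> carrier_vec nc" if v: "v \<in> carrier_vec nr" for v
    proof -
      have "G *\<^sub>v (G\<^sup>T *\<^sub>v (M' *\<^sub>v v)) = M *\<^sub>v (M' *\<^sub>v v)"
        unfolding M_def using G GT M' v by (intro assoc_mult_mat_vec[symmetric]) auto
      also have "\<dots> = (M * M') *\<^sub>v v" using M M' v by (intro assoc_mult_mat_vec[symmetric]) auto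
      finally show ?thesis using M' v GT by simp
    qed
    then show False using assms(2) by blast
  qed
  then obtain w where w: "w \<in> carrier_vec nr" "w \<noteq> 0\<^sub>v nr" "M *\<^sub>v w = 0\<^sub>v nr" by blast
  define x where "x = G\<^sup>T *\<^sub>v w"
  have x: "x \<in> carrier_vec nc" using GT w by (simp add: x_def)
  \<comment> \<open>A kernel vector of the Gram matrix is already annihilated by the transpose,
    because the squared length of \<open>x\<close> equals the product of \<open>w\<close> with
    \<open>M w = 0\<close>.\<close>
  have "Matrix.scalar_prod x x = Matrix.scalar_prod w (G *\<^sub>v x)"
    using transpose_vec_mult_scalar[OF G x w(1)] by (simp add: x_def)
  also have "G *\<^sub>v x = 0\<^sub>v nr"
    unfolding x_def using w assoc_mult_mat_vec[OF G GT w(1)] by (simp add: M_def)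
  finally have "Matrix.scalar_prod x x = 0" using w by simp
  then have "(\<Sum>i<nc. (x $ i)^2) = 0" using x by (simp add: scalar_prod_def power2_eq_square atLeast0LessThan)
  then have "\<forall>i\<in>{..<nc}. (x $ i)^2 = 0"
    using sum_nonneg_eq_0_iff[of "{..<nc}" "\<lambda>i. (x $ i)^2"] by simp
  then have "x = 0\<^sub>v nc" using x by (intro eq_vecI) simp_all
  then show ?thesis using that[OF w(1,2)] by (simp add: x_def)
qed

section \<open>Comparison of an arbitrary norm with the sum of absolute coordinates\<close>

lemma vec_norm_le_sum:
  assumes N: "vec_norm_on n N"
  obtains C where "C > 0" "\<And>v. v \<in> carrier_vec n \<Longrightarrow> N v \<le> C * (\<Sum>i<n. \<bar>v $ i\<bar>)"
proof -
  \<comment> \<open>The summand 1 keeps \<open>C\<close> positive even for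
    \<open>n = 0\<close>.\<close>
  define C where "C = (\<Sum>i<n. N (unit_vec n i)) + 1"
  have pos: "N v \<ge> 0" and scale: "N (c \<cdot>\<^sub>v v) = \<bar>c\<bar> * N v" and N0: "N (0\<^sub>v n) = 0"
    if "v \<in> carrier_vec n" for v c
    using N that by (auto simp: vec_norm_on_def)
  have tri: "N (v + w) \<le> N v + N w" if "v \<in> carrier_vec n" "w \<in> carrier_vec n" for v w
    using N that by (auto simp: vec_norm_on_def)
  have NC: "N (unit_vec n i) \<le> C" if "i < n" for i
  proof -
    have "N (unit_vec n i) \<le> (\<Sum>i<n. N (unit_vec n i))"
      using that by (intro member_le_sum pos) auto
    then show ?thesis by (simp add: C_def)
  qed
  have "N v \<le> C * (\<Sum>i<n. \<bar>v $ i\<bar>)" if v: "v \<in> carrier_vec n" for v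
  proof -
    \<comment> \<open>Passing from the first \<open>k\<close> coordinates to \<open>k + 1\<close>
      adds a multiple of one unit vector, at the cost of one triangle inequality.\<close>
    have "N (vec n (\<lambda>i. if i < k then v $ i else 0)) \<le> C * (\<Sum>i<k. \<bar>v $ i\<bar>)" if "k \<le> n" for k
      using that
    proof (induction k)
      case 0
      have "vec n (\<lambda>i. 0) = (0\<^sub>v n :: real vec)" by auto
      then show ?case using N0[OF v] by (simp del: index_vec)
    next
      case (Suc k)
      have eq: "vec n (\<lambda>i. if i < Suc k then v $ i else 0)
          = vec n (\<lambda>i. if i < k then v $ i else 0) + v $ k \<cdot>\<^sub>v unit_vec n k"
        using Suc.prems by (intro eq_vecI) (simp_all add: less_Suc_eq)
      have "N (vec n (\<lambda>i. if i < Suc k then v $ i else 0))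
        \<le> N (vec n (\<lambda>i. if i < k then v $ i else 0)) + N (v $ k \<cdot>\<^sub>v unit_vec n k)"
        unfolding eq by (intro tri) auto
      also have "\<dots> \<le> C * (\<Sum>i<k. \<bar>v $ i\<bar>) + \<bar>v $ k\<bar> * C"
        using Suc NC[of k] by (intro add_mono) (simp_all add: scale mult_left_mono)
      finally show ?case by (simp add: algebra_simps)
    qed
    from this[of n] have "N (vec n (\<lambda>i. if i < n then v $ i else 0)) \<le> C * (\<Sum>i<n. \<bar>v $ i\<bar>)" by simp
    moreover have "vec n (\<lambda>i. if i < n then v $ i else 0) = v" using v by auto
    ultimately show ?thesis by simp
  qed
  moreover have "C > 0"
    unfolding C_def by (intro add_nonneg_pos sum_nonneg pos) simp_all
  ultimately show ?thesis using that by blast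
qed

text \<open>By compactness \<open>N\<close> attains its minimum on the unit sphere of the coordinate
  sum. The minimum is positive by definiteness, and homogeneity carries the bound to all vectors.
  The sphere is taken among functions on \<open>nat\<close> that vanish from \<open>n\<close> on,
  where it lies in a product of compact intervals.\<close>

lemma sum_le_vec_norm:
  assumes N: "vec_norm_on n N"
  obtains c where "c > 0" "\<And>v. v \<in> carrier_vec n \<Longrightarrow> (\<Sum>i<n. \<bar>v $ i\<bar>) \<le> c * N v"
proof (cases "n = 0")
  case True
  show ?thesis
    by (rule that[of 1]) (use N True in \<open>auto simp: vec_norm_on_def\<close>)
next
  case False
  have pos: "N v \<ge> 0" and scale: "N (c \<cdot>\<^sub>v v) = \<bar>c\<bar> * N v"
    and zero: "N v = 0 \<longleftrightarrow> v = 0\<^sub>v n" if "v \<in> carrier_vec n" for v c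
    using N that by (auto simp: vec_norm_on_def)
  have tri: "N (v + w) \<le> N v + N w" if "v \<in> carrier_vec n" "w \<in> carrier_vec n" for v w
    using N that by (auto simp: vec_norm_on_def)
  obtain C where C: "C > 0" "\<And>v. v \<in> carrier_vec n \<Longrightarrow> N v \<le> C * (\<Sum>i<n. \<bar>v $ i\<bar>)"
    using vec_norm_le_sum[OF N] by blast
  define P where "P = (PiE UNIV (\<lambda>i. if i < n then {-1..1} else {0}) :: (nat \<Rightarrow> real) set)"
  define S where "S = P \<inter> {x. (\<Sum>i<n. \<bar>x i\<bar>) = 1}"
  have "compactin (product_topology (\<lambda>i. euclidean) UNIV) P"
    unfolding P_def by (subst compactin_PiE) auto
  then have "compact P"
    by (simp add: euclidean_product_topology)
  moreover have coord: "continuous_on UNIV (\<lambda>x::nat \<Rightarrow> real. x i)" for i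
    by (rule continuous_on_product_coordinates)
  have "closed {x :: nat \<Rightarrow> real. (\<Sum>i<n. \<bar>x i\<bar>) = 1}"
    by (intro closed_Collect_eq continuous_intros coord)
  ultimately have "compact S" unfolding S_def by (rule compact_Int_closed)
  \<comment> \<open>The upper bound makes \<open>N\<close> Lipschitz in the coordinates, hence
    continuous for the product topology.\<close>
  have lip: "\<bar>N (vec n x) - N (vec n y)\<bar> \<le> C * (\<Sum>i<n. \<bar>x i - y i\<bar>)" for x y
  proof -
    have *: "N (vec n x) \<le> N (vec n y) + C * (\<Sum>i<n. \<bar>x i - y i\<bar>)" for x y
    proof -
      have "vec n x = vec n y + vec n (\<lambda>i. x i - y i)" by auto
      then have "N (vec n x) \<le> N (vec n y) + N (vec n (\<lambda>i. x i - y i))"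
        using tri[of "vec n y" "vec n (\<lambda>i. x i - y i)"] by simp
      also have "N (vec n (\<lambda>i. x i - y i)) \<le> C * (\<Sum>i<n. \<bar>x i - y i\<bar>)"
        using C(2)[of "vec n (\<lambda>i. x i - y i)"] by simp
      finally show ?thesis by simp
    qed
    show ?thesis using *[of x y] *[of y x] by (simp add: abs_minus_commute abs_le_iff algebra_simps)
  qed
  have "continuous_on S (\<lambda>x. N (vec n x))"
    unfolding continuous_on_def
  proof
    fix x assume "x \<in> S"
    have "((\<lambda>y. C * (\<Sum>i<n. \<bar>y i - x i\<bar>)) \<longlongrightarrow> C * (\<Sum>i<n. \<bar>x i - x i\<bar>)) (at x within S)"
    proof (intro tendsto_intros)
      fix i show "((\<lambda>y. y i) \<longlongrightarrow> x i) (at x within S)"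
        using coord[of i] by (meson UNIV_I continuous_on_def continuous_on_subset subset_UNIV \<open>x \<in> S\<close>)
    qed
    then have "((\<lambda>y. N (vec n y) - N (vec n x)) \<longlongrightarrow> 0) (at x within S)"
      by (intro Lim_null_comparison[OF _ \<open>((\<lambda>y. C * (\<Sum>i<n. \<bar>y i - x i\<bar>)) \<longlongrightarrow> C * (\<Sum>i<n. \<bar>x i - x i\<bar>)) (at x within S)\<close>[simplified]])
         (simp add: lip)
    then show "((\<lambda>y. N (vec n y)) \<longlongrightarrow> N (vec n x)) (at x within S)"
      by (simp add: LIM_zero_iff)
  qed
  moreover have "S \<noteq> {}"
  proof -
    have "(\<lambda>i. if i = 0 then 1 else 0) \<in> S"
      using False by (auto simp: S_def P_def if_distrib[of abs] cong: if_cong)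
    then show ?thesis by blast
  qed
  ultimately obtain x where x: "x \<in> S" "\<And>y. y \<in> S \<Longrightarrow> N (vec n x) \<le> N (vec n y)"
    using continuous_attains_inf[OF \<open>compact S\<close>] by blast
  have "vec n x \<noteq> 0\<^sub>v n"
  proof
    assume "vec n x = 0\<^sub>v n"
    then have "x i = 0" if "i < n" for i using that by (metis index_vec index_zero_vec(1))
    then show False using x(1) by (simp add: S_def)
  qed
  then have mpos: "N (vec n x) > 0" using zero[of "vec n x"] pos[of "vec n x"] by simp
  show ?thesis
  proof (rule that[of "1 / N (vec n x)"])
    show "1 / N (vec n x) > 0" using mpos by simp
    fix v :: "real vec" assume v: "v \<in> carrier_vec n"
    define s where "s = (\<Sum>i<n. \<bar>v $ i\<bar>)"
    show "(\<Sum>i<n. \<bar>v $ i\<bar>) \<le> 1 / N (vec n x) * N v"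
    proof (cases "s = 0")
      case True
      then show ?thesis using pos[OF v] mpos by (simp add: s_def)
    next
      case False
      moreover have "s \<ge> 0" by (simp add: s_def sum_nonneg)
      ultimately have s: "s > 0" by simp
      have le: "\<bar>v $ i\<bar> \<le> s" if "i < n" for i
        unfolding s_def using that by (intro member_le_sum) auto
      define y where "y = (\<lambda>i. if i < n then v $ i / s else 0)"
      have "(\<Sum>i<n. \<bar>y i\<bar>) = (\<Sum>i<n. \<bar>v $ i\<bar> / s)"
        using s by (intro sum.cong) (auto simp: y_def)
      then have "(\<Sum>i<n. \<bar>y i\<bar>) = 1"
        using s by (simp add: sum_divide_distrib[symmetric] s_def[symmetric])
      moreover have "v $ i / s \<in> {-1..1}" if "i < n" for i
        using le[OF that] s by (simp add: abs_le_iff field_simps)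
      then have "y \<in> P" by (auto simp: P_def y_def PiE_iff)
      ultimately have "y \<in> S" by (simp add: S_def)
      moreover have "vec n y = (1 / s) \<cdot>\<^sub>v v" using v by (auto simp: y_def)
      ultimately have "N (vec n x) \<le> 1 / s * N v" using x(2)[of y] scale[OF v, of "1/s"] s by simp
      then show ?thesis using s mpos by (simp add: s_def[symmetric] field_simps)
    qed
  qed
qed

section \<open>The coordinates of the system matrix\<close>

text \<open>Each row of the block matrix has at most two nonzero entries: \<open>diag_entry\<close>
  on the diagonal and \<open>off_entry\<close> in the column \<open>partner r i\<close>. For a
  one-dimensional block the two columns coincide and the second entry is 0, so one formula serves
  both kinds of block.\<close>

definition diag_entry :: "nat \<Rightarrow> (nat \<Rightarrow> real \<Rightarrow> real) \<Rightarrow> (nat \<Rightarrow> real \<Rightarrow> real) \<Rightarrow> nat \<Rightarrow> real \<Rightarrow> real" where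
  "diag_entry r lam \<alpha> i \<beta> = (if i < r then lam i \<beta> else \<alpha> ((i - r) div 2) \<beta>)"

definition off_entry :: "nat \<Rightarrow> (nat \<Rightarrow> real \<Rightarrow> real) \<Rightarrow> nat \<Rightarrow> real \<Rightarrow> real" where
  "off_entry r \<omega> i \<beta> =
     (if i < r then 0 else if even (i - r) then - \<omega> ((i - r) div 2) \<beta> else \<omega> ((i - r) div 2) \<beta>)"

definition partner :: "nat \<Rightarrow> nat \<Rightarrow> nat" where
  "partner r i = (if i < r then i else if even (i - r) then Suc i else i - 1)"

text \<open>Names the block \<open>q\<close> and the position inside it, so that facts about
  coordinates become simplifications without \<open>div\<close> or parity.\<close>

lemma index_cases:
  fixes i r :: nat
  obtains "i < r" | q where "i = r + 2 * q" | q where "i = Suc (r + 2 * q)"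
proof -
  have "i < r \<or> (\<exists>q. i = r + 2 * q) \<or> (\<exists>q. i = Suc (r + 2 * q))" by presburger
  then show thesis using that by blast
qed

lemma partner_simps [simp]:
  "i < r \<Longrightarrow> partner r i = i"
  "partner r (r + 2 * q) = Suc (r + 2 * q)"
  "partner r (Suc (r + 2 * q)) = r + 2 * q"
  by (simp_all add: partner_def)

lemma diag_entry_simps [simp]:
  "i < r \<Longrightarrow> diag_entry r lam \<alpha> i = lam i"
  "diag_entry r lam \<alpha> (r + 2 * q) = \<alpha> q"
  "diag_entry r lam \<alpha> (Suc (r + 2 * q)) = \<alpha> q"
  by (simp_all add: diag_entry_def fun_eq_iff)

lemma off_entry_simps [simp]:
  "i < r \<Longrightarrow> off_entry r \<omega> i \<beta> = 0"
  "off_entry r \<omega> (r + 2 * q) \<beta> = - \<omega> q \<beta>"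
  "off_entry r \<omega> (Suc (r + 2 * q)) \<beta> = \<omega> q \<beta>"
  by (simp_all add: off_entry_def)

lemma partner_less: "i < r + 2 * l \<Longrightarrow> partner r i < r + 2 * l"
  by (cases i r rule: index_cases) auto

lemma partner_partner: "partner r (partner r i) = i"
  by (cases i r rule: index_cases) simp_all

lemma diag_entry_partner: "diag_entry r lam \<alpha> (partner r i) = diag_entry r lam \<alpha> i"
  by (cases i r rule: index_cases) simp_all

lemma off_entry_partner: "off_entry r \<omega> (partner r i) \<beta> = - off_entry r \<omega> i \<beta>"
  by (cases i r rule: index_cases) simp_all

lemma partner_Suc: "partner (Suc r) (Suc i) = Suc (partner r i)"
  by (cases i r rule: index_cases) (simp_all add: partner_def)

lemma partner_0_add_2: "partner 0 (i + 2) = partner 0 i + 2"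
  by (cases i "0 :: nat" rule: index_cases) (simp_all add: partner_def)

lemma sys_mat_carrier: "sys_mat r l lam \<alpha> \<omega> \<beta> \<in> carrier_mat (r + 2 * l) (r + 2 * l)"
proof
  have *: "sum_list (map (\<lambda>x. c) [0..<k]) = k * c" for k c :: nat
    by (induction k) auto
  show "dim_row (sys_mat r l lam \<alpha> \<omega> \<beta>) = r + 2 * l" "dim_col (sys_mat r l lam \<alpha> \<omega> \<beta>) = r + 2 * l"
    unfolding sys_mat_def
    by (simp_all add: dim_diag_block_mat o_def rot_block_def mat_of_rows_list_def *)
qed

lemma sys_mat_Suc:
  "sys_mat (Suc r) l lam \<alpha> \<omega> \<beta> =
     four_block_mat (mat 1 1 (\<lambda>_. lam 0 \<beta>)) (0\<^sub>m 1 (r + 2 * l)) (0\<^sub>m (r + 2 * l) 1)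
       (sys_mat r l (\<lambda>j. lam (Suc j)) \<alpha> \<omega> \<beta>)"
proof -
  have "map (\<lambda>j. mat 1 1 (\<lambda>_. lam j \<beta>)) [0..<Suc r]
      = mat 1 1 (\<lambda>_. lam 0 \<beta>) # map (\<lambda>j. mat 1 1 (\<lambda>_. lam (Suc j) \<beta>)) [0..<r]"
    by (simp add: upt_conv_Cons map_Suc_upt[symmetric] o_def del: upt_Suc)
  then show ?thesis
    using sys_mat_carrier[of r l "\<lambda>j. lam (Suc j)" \<alpha> \<omega> \<beta>]
    by (simp add: sys_mat_def Let_def del: upt_Suc)
qed

lemma sys_mat_0_Suc:
  "sys_mat 0 (Suc l) lam \<alpha> \<omega> \<beta> =
     four_block_mat (rot_block (\<alpha> 0 \<beta>) (\<omega> 0 \<beta>)) (0\<^sub>m 2 (2 * l)) (0\<^sub>m (2 * l) 2)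
       (sys_mat 0 l lam (\<lambda>j. \<alpha> (Suc j)) (\<lambda>j. \<omega> (Suc j)) \<beta>)"
proof -
  have "map (\<lambda>j. rot_block (\<alpha> j \<beta>) (\<omega> j \<beta>)) [0..<Suc l]
      = rot_block (\<alpha> 0 \<beta>) (\<omega> 0 \<beta>) # map (\<lambda>j. rot_block (\<alpha> (Suc j) \<beta>) (\<omega> (Suc j) \<beta>)) [0..<l]"
    by (simp add: upt_conv_Cons map_Suc_upt[symmetric] o_def del: upt_Suc)
  moreover have "dim_row (rot_block a w) = 2" "dim_col (rot_block a w) = 2" for a w
    by (simp_all add: rot_block_def mat_of_rows_list_def)
  ultimately show ?thesis
    using sys_mat_carrier[of 0 l lam "\<lambda>j. \<alpha> (Suc j)" "\<lambda>j. \<omega> (Suc j)" \<beta>]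
    by (simp add: sys_mat_def Let_def del: upt_Suc)
qed

text \<open>The leading block is peeled off: the one-dimensional blocks first, then, for
  \<open>r = 0\<close>, the rotation blocks. Peeling shifts the families by one index, which is why
  they are generalised in the inductions.\<close>

lemma sys_mat_index:
  assumes "i < r + 2 * l" "k < r + 2 * l"
  shows "sys_mat r l lam \<alpha> \<omega> \<beta> $$ (i, k) =
    (if k = i then diag_entry r lam \<alpha> i \<beta> else 0) + (if k = partner r i then off_entry r \<omega> i \<beta> else 0)"
  using assms
proof (induction r arbitrary: lam i k)
  case 0
  then show ?case
  proof (induction l arbitrary: \<alpha> \<omega> i k)
    case 0
    then show ?case by simp
  next
    case (Suc l)
    have rot: "dim_row (rot_block a w) = 2" "dim_col (rot_block a w) = 2" for a w
      by (simp_all add: rot_block_def mat_of_rows_list_def)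
    have rot_index: "rot_block a w $$ (i, k) = (if k = i then a else if i = 0 then - w else w)"
      if "i < 2" "k < 2" for a w i k
      using that by (auto simp: rot_block_def mat_of_rows_list_def less_2_cases_iff)
    have dims: "dim_row (sys_mat 0 l lam \<alpha>' \<omega>' \<beta>) = 2 * l" "dim_col (sys_mat 0 l lam \<alpha>' \<omega>' \<beta>) = 2 * l" for \<alpha>' \<omega>'
      using sys_mat_carrier[of 0 l lam \<alpha>' \<omega>' \<beta>] by auto
    consider "i < 2" "k < 2" | "i < 2" "k \<ge> 2" | "i \<ge> 2" "k < 2" | "i \<ge> 2" "k \<ge> 2"
      by linarith
    then show ?case
    proof cases
      case 1
      then show ?thesis
        using Suc.prems unfolding sys_mat_0_Suc
        by (auto simp: rot dims rot_index diag_entry_def off_entry_def partner_def less_2_cases_iff)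
    next
      case 2
      then show ?thesis
        using Suc.prems unfolding sys_mat_0_Suc
        by (auto simp: rot dims partner_def less_2_cases_iff)
    next
      case 3
      have "k \<noteq> partner 0 i"
        using 3 by (cases "i = 2") (auto simp: partner_def elim: oddE)
      then show ?thesis
        using 3 Suc.prems unfolding sys_mat_0_Suc
        by (auto simp: rot dims)
    next
      case 4
      then obtain i' k' where eq: "i = i' + 2" "k = k' + 2" by (metis le_add_diff_inverse2)
      then show ?thesis
        using Suc.prems Suc.IH[of i' k' "\<lambda>j. \<alpha> (Suc j)" "\<lambda>j. \<omega> (Suc j)"] unfolding sys_mat_0_Suc
        by (simp add: rot dims diag_entry_def off_entry_def partner_0_add_2[simplified])
    qed
  qed
next
  case (Suc r)
  have carr: "sys_mat r l lam' \<alpha> \<omega> \<beta> \<in> carrier_mat (r + 2 * l) (r + 2 * l)" for lam'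
    by (rule sys_mat_carrier)
  have "partner (Suc r) 0 = 0" by (simp add: partner_def)
  then show ?case
    using Suc.prems Suc.IH[of "i - 1" "k - 1" "\<lambda>j. lam (Suc j)"] unfolding sys_mat_Suc
    by (cases i; cases k) (auto simp: carrier_matD[OF carr] diag_entry_def off_entry_def partner_Suc)
qed

lemma sys_mat_mult_vec_index:
  assumes v: "v \<in> carrier_vec (r + 2 * l)" and i: "i < r + 2 * l"
  shows "(sys_mat r l lam \<alpha> \<omega> \<beta> *\<^sub>v v) $ i
    = diag_entry r lam \<alpha> i \<beta> * v $ i + off_entry r \<omega> i \<beta> * v $ partner r i"
proof -
  define M where "M = sys_mat r l lam \<alpha> \<omega> \<beta>"
  have M: "M \<in> carrier_mat (r + 2 * l) (r + 2 * l)" unfolding M_def by (rule sys_mat_carrier)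
  have "(M *\<^sub>v v) $ i = (\<Sum>k<r + 2 * l. M $$ (i, k) * v $ k)"
    using M v i by (simp add: scalar_prod_def atLeast0LessThan)
  also have "\<dots> = (\<Sum>k<r + 2 * l. (if k = i then diag_entry r lam \<alpha> i \<beta> * v $ k else 0)
      + (if k = partner r i then off_entry r \<omega> i \<beta> * v $ k else 0))"
    unfolding M_def using i by (intro sum.cong) (auto simp: sys_mat_index distrib_right)
  also have "\<dots> = diag_entry r lam \<alpha> i \<beta> * v $ i + off_entry r \<omega> i \<beta> * v $ partner r i"
    using i partner_less[OF i] by (simp add: sum.distrib)
  finally show ?thesis unfolding M_def .
qed

text \<open>Transposing a rotation block reverses its sense of rotation, so the facts about
  \<open>sys_mat\<close> carry over.\<close>

lemma sys_mat_adj_eq: "sys_mat_adj r l lam \<alpha> \<omega> = sys_mat r l lam \<alpha> (\<lambda>j \<beta>. - \<omega> j \<beta>)"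
  by (rule ext) (simp add: sys_mat_adj_def sys_mat_def rot_block_adj_def rot_block_def)

lemma off_entry_uminus: "off_entry r (\<lambda>j \<beta>. - \<omega> j \<beta>) i \<beta> = - off_entry r \<omega> i \<beta>"
  by (simp add: off_entry_def)

section \<open>Density of modules over polynomials\<close>

text \<open>A partition of unity on the range of the \<open>\<rho> i\<close> glues the local approximations that the fibre
  condition provides, and polynomials approximate the partition functions.\<close>
lemma Stone_Weierstrass_module:
  fixes K :: "'a::topological_space set" and I :: "'i set"
    and \<rho> :: "'i \<Rightarrow> 'a \<Rightarrow> 'z::euclidean_space" and L :: "('i \<Rightarrow> 'a \<Rightarrow> real) set"
  assumes K: "compact K" and I: "finite I"
    and \<rho>: "\<And>i. i \<in> I \<Longrightarrow> continuous_on K (\<rho> i)"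
    and L: "\<And>f i. f \<in> L \<Longrightarrow> i \<in> I \<Longrightarrow> continuous_on K (f i)"
    and zero: "(\<lambda>i x. 0) \<in> L"
    and add: "\<And>f g. f \<in> L \<Longrightarrow> g \<in> L \<Longrightarrow> (\<lambda>i x. f i x + g i x) \<in> L"
    and mult: "\<And>f p. f \<in> L \<Longrightarrow> real_polynomial_function p \<Longrightarrow> (\<lambda>i x. p (\<rho> i x) * f i x) \<in> L"
    and g: "\<And>i. i \<in> I \<Longrightarrow> continuous_on K (g i)"
    and fibre: "\<And>z. \<exists>f\<in>L. \<forall>i\<in>I. \<forall>x\<in>K. \<rho> i x = z \<longrightarrow> f i x = g i x"
    and "\<epsilon> > 0"
  shows "\<exists>f\<in>L. \<forall>i\<in>I. \<forall>x\<in>K. \<bar>f i x - g i x\<bar> < \<epsilon>"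
proof -
  \<comment> \<open>A polynomial acts on coordinate \<open>i\<close> through its value at
    \<open>\<rho> i x\<close>, so the partition must live in the space of values, in one compact set
    shared by all coordinates.\<close>
  define Q where "Q = (\<Union>i\<in>I. \<rho> i ` K)"
  have Q: "compact Q"
    unfolding Q_def using I by (intro compact_UN compact_continuous_image \<rho> K)
  obtain F where F: "\<And>z. F z \<in> L" "\<And>z i x. i \<in> I \<Longrightarrow> x \<in> K \<Longrightarrow> \<rho> i x = z \<Longrightarrow> F z i x = g i x"
    using fibre by metis
  define C where "C z i = {x \<in> K. \<epsilon> / 2 \<le> \<bar>F z i x - g i x\<bar>}" for z i
  \<comment> \<open>The values over which \<open>F z\<close> is nowhere off by \<epsilon>/2 or more,
    in any coordinate. The complement is a finite union of continuous images of compact sets, hence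
    closed.\<close>
  define U where "U z = - (\<Union>i\<in>I. \<rho> i ` C z i)" for z
  have "compact (\<Union>i\<in>I. \<rho> i ` C z i)" for z
  proof (intro compact_UN[OF I] compact_continuous_image)
    fix i assume i: "i \<in> I"
    have "continuous_on K (\<lambda>x. \<bar>F z i x - g i x\<bar>)"
      by (intro continuous_intros L g i F(1))
    then have "closedin (top_of_set K) (K \<inter> (\<lambda>x. \<bar>F z i x - g i x\<bar>) -` {\<epsilon> / 2..})"
      by (rule continuous_closedin_preimage) simp
    moreover have "K \<inter> (\<lambda>x. \<bar>F z i x - g i x\<bar>) -` {\<epsilon> / 2..} = C z i"
      by (auto simp: C_def)
    ultimately show "compact (C z i)" using closedin_compact[OF K] by metis
    show "continuous_on (C z i) (\<rho> i)"
      using \<rho>[OF i] by (rule continuous_on_subset) (auto simp: C_def)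
  qed
  then have openU: "open (U z)" for z
    unfolding U_def by (intro open_Compl compact_imp_closed)
  have zU: "z \<in> U z" for z
    unfolding U_def C_def using F(2) \<open>\<epsilon> > 0\<close> by auto
  have near: "\<bar>F z i x - g i x\<bar> < \<epsilon> / 2" if "i \<in> I" "x \<in> K" "\<rho> i x \<in> U z" for z i x
    using that unfolding U_def C_def by force
  obtain D where D: "D \<subseteq> Q" "finite D" "Q \<subseteq> (\<Union>z\<in>D. U z)"
    using compactE_image[OF Q, of Q U] openU zU by blast
  define W where "W = U ` D"
  have finW: "finite W" using D by (simp add: W_def)
  \<comment> \<open>The partition of unity is indexed by the open sets themselves, so each set needs
    a chosen \<open>c V\<close> to provide its local approximation.\<close>
  have "\<forall>V\<in>W. \<exists>z. V = U z" by (auto simp: W_def)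
  then obtain c where c: "\<And>V. V \<in> W \<Longrightarrow> V = U (c V)" by metis
  define F' where "F' V = F (c V)" for V
  have QW: "Q \<subseteq> \<Union>W" using D by (simp add: W_def)
  have opW: "\<And>V. V \<in> W \<Longrightarrow> open V" using openU by (auto simp: W_def)
  have locfin: "\<exists>V. open V \<and> x \<in> V \<and> finite {U \<in> W. U \<inter> V \<noteq> {}}" if "x \<in> Q" for x
    by (rule exI[of _ UNIV]) (simp add: finW)
  have "\<exists>H :: 'z set \<Rightarrow> 'z \<Rightarrow> real. (\<forall>V\<in>W. continuous_on Q (H V) \<and> (\<forall>x\<in>Q. 0 \<le> H V x)) \<and>
      (\<forall>x\<in>Q. \<forall>V\<in>W. x \<notin> V \<longrightarrow> H V x = 0) \<and> (\<forall>x\<in>Q. supp_sum (\<lambda>V. H V x) W = 1)"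
  proof (rule subordinate_partition_of_unity[OF QW opW locfin])
    fix H :: "'z set \<Rightarrow> 'z \<Rightarrow> real"
    assume "\<And>V. V \<in> W \<Longrightarrow> continuous_on Q (H V) \<and> (\<forall>x\<in>Q. 0 \<le> H V x)"
      "\<And>x V. V \<in> W \<Longrightarrow> x \<in> Q \<Longrightarrow> x \<notin> V \<Longrightarrow> H V x = 0"
      "\<And>x. x \<in> Q \<Longrightarrow> supp_sum (\<lambda>V. H V x) W = 1"
    then show ?thesis by (intro exI[of _ H]) simp
  qed
  then obtain H :: "'z set \<Rightarrow> 'z \<Rightarrow> real"
    where *: "(\<forall>V\<in>W. continuous_on Q (H V) \<and> (\<forall>x\<in>Q. 0 \<le> H V x)) \<and>
      (\<forall>x\<in>Q. \<forall>V\<in>W. x \<notin> V \<longrightarrow> H V x = 0) \<and> (\<forall>x\<in>Q. supp_sum (\<lambda>V. H V x) W = 1)" ..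
  have H: "continuous_on Q (H V) \<and> (\<forall>x\<in>Q. 0 \<le> H V x)" if "V \<in> W" for V
    using * that by simp
  have H0: "H V x = 0" if "V \<in> W" "x \<in> Q" "x \<notin> V" for x V
    using * that by simp
  have H1: "supp_sum (\<lambda>V. H V x) W = 1" if "x \<in> Q" for x
    using * that by simp
  have H_sum: "(\<Sum>V\<in>W. H V x) = 1" if "x \<in> Q" for x
  proof -
    have "supp_sum (\<lambda>V. H V x) W = (\<Sum>V\<in>W. H V x)"
      unfolding supp_sum_def support_on_def using finW by (intro sum.mono_neutral_left) auto
    then show ?thesis using H1[OF that] by simp
  qed
  define b where "b V i = (SOME b. b \<ge> 0 \<and> (\<forall>x\<in>K. \<bar>F' V i x\<bar> \<le> b))" for V i
  have b_spec: "b V i \<ge> 0 \<and> (\<forall>x\<in>K. \<bar>F' V i x\<bar> \<le> b V i)" if "i \<in> I" for V i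
    unfolding b_def
  proof (rule someI_ex)
    have "compact ((F' V i) ` K)"
      unfolding F'_def by (intro compact_continuous_image L F K that)
    then have "bounded ((F' V i) ` K)" by (rule compact_imp_bounded)
    then obtain b where "\<forall>x\<in>K. \<bar>F' V i x\<bar> \<le> b" by (auto simp: bounded_iff)
    then show "\<exists>b\<ge>0. \<forall>x\<in>K. \<bar>F' V i x\<bar> \<le> b"
      by (intro exI[of _ "max b 0"]) fastforce
  qed
  then have b: "b V i \<ge> 0" "x \<in> K \<Longrightarrow> \<bar>F' V i x\<bar> \<le> b V i" if "i \<in> I" for V i x
    using that by auto
  define B where "B = (\<Sum>V\<in>W. \<Sum>i\<in>I. b V i)"
  have B: "B \<ge> 0" unfolding B_def by (intro sum_nonneg b)
  \<comment> \<open>The polynomial errors, weighted by the bounds on the \<open>F' V\<close>, must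
    add up to less than \<epsilon>/2; the \<open>1 +\<close> covers \<open>B = 0\<close>.\<close>
  define \<delta> where "\<delta> = \<epsilon> / (2 * (1 + B))"
  have \<delta>: "\<delta> > 0" using \<open>\<epsilon> > 0\<close> B by (simp add: \<delta>_def)
  have "\<exists>p. real_polynomial_function p \<and> (\<forall>x\<in>Q. \<bar>H V x - p x\<bar> < \<delta>)" if "V \<in> W" for V
  proof -
    have "continuous_on Q (H V)" using H[OF that] by simp
    then show ?thesis
      by (rule Stone_Weierstrass_real_polynomial_function[OF Q _ \<delta>]) blast
  qed
  then obtain p where p: "\<And>V. V \<in> W \<Longrightarrow> real_polynomial_function (p V)"
      "\<And>V x. V \<in> W \<Longrightarrow> x \<in> Q \<Longrightarrow> \<bar>H V x - p V x\<bar> < \<delta>"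
    by metis
  define f where "f i x = (\<Sum>V\<in>W. p V (\<rho> i x) * F' V i x)" for i x
  have "(\<lambda>i x. \<Sum>V\<in>W'. p V (\<rho> i x) * F' V i x) \<in> L" if "W' \<subseteq> W" for W'
    using finite_subset[OF that finW] that
  proof (induction W' rule: finite_induct)
    case empty
    then show ?case using zero by simp
  next
    case (insert V W')
    then show ?case using add[OF mult[OF F(1) p(1), of V "c V"]] by (simp add: F'_def)
  qed
  then have "f \<in> L" unfolding f_def by blast
  moreover have "\<bar>f i x - g i x\<bar> < \<epsilon>" if i: "i \<in> I" and x: "x \<in> K" for i x
  proof -
    define y where "y = \<rho> i x"
    have y: "y \<in> Q" using i x by (auto simp: y_def Q_def)
    have "g i x = (\<Sum>V\<in>W. H V y * g i x)"
      using H_sum[OF y] by (simp add: sum_distrib_right[symmetric])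
    \<comment> \<open>The first sum is a convex combination of local errors, since
      \<open>H V y\<close> vanishes unless \<open>y\<close> lies in \<open>V\<close>. The second is
      the cost of replacing the weights by polynomials.\<close>
    then have "f i x - g i x = (\<Sum>V\<in>W. H V y * (F' V i x - g i x)) + (\<Sum>V\<in>W. (p V y - H V y) * F' V i x)"
      by (simp add: f_def y_def[symmetric] algebra_simps sum.distrib sum_subtractf)
    moreover have "\<bar>\<Sum>V\<in>W. H V y * (F' V i x - g i x)\<bar> \<le> (\<Sum>V\<in>W. H V y * (\<epsilon> / 2))"
    proof (rule sum_abs[THEN order_trans], rule sum_mono)
      fix V assume V: "V \<in> W"
      show "\<bar>H V y * (F' V i x - g i x)\<bar> \<le> H V y * (\<epsilon> / 2)"
      proof (cases "y \<in> V")
        case True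
        then have "\<bar>F' V i x - g i x\<bar> \<le> \<epsilon> / 2"
          using near[OF i x, of "c V"] c[OF V] by (simp add: y_def F'_def)
        moreover have "H V y \<ge> 0" using H[OF V] y by simp
        ultimately show ?thesis
          unfolding abs_mult by (intro mult_mono) auto
      next
        case False
        then show ?thesis using H0[OF V y] by simp
      qed
    qed
    moreover have "(\<Sum>V\<in>W. H V y * (\<epsilon> / 2)) = \<epsilon> / 2"
      unfolding sum_distrib_right[symmetric] by (simp add: H_sum[OF y])
    moreover have "\<bar>\<Sum>V\<in>W. (p V y - H V y) * F' V i x\<bar> \<le> (\<Sum>V\<in>W. \<delta> * b V i)"
    proof (rule sum_abs[THEN order_trans], rule sum_mono)
      fix V assume V: "V \<in> W"
      have "\<bar>p V y - H V y\<bar> \<le> \<delta>" using p(2)[OF V y] by (simp add: abs_minus_commute)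
      then show "\<bar>(p V y - H V y) * F' V i x\<bar> \<le> \<delta> * b V i"
        unfolding abs_mult using b[OF i] x \<delta> by (intro mult_mono) auto
    qed
    moreover have "(\<Sum>V\<in>W. \<delta> * b V i) \<le> \<delta> * B"
      unfolding B_def sum_distrib_left[symmetric] using i I b \<delta>
      by (intro mult_left_mono sum_mono member_le_sum) auto
    moreover have "\<delta> * B < \<epsilon> / 2"
      using \<open>\<epsilon> > 0\<close> B by (simp add: \<delta>_def field_simps)
    ultimately show ?thesis by linarith
  qed
  ultimately show ?thesis by blast
qed

section \<open>Responses to step inputs\<close>

text \<open>Taylor remainders of the exponential: \<open>exp w = (\<Sum>j\<le>k. w ^ j / j!) + w ^ (k + 1) * exp_tail k w\<close>.\<close>
definition exp_tail :: "nat \<Rightarrow> complex \<Rightarrow> complex" where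
  "exp_tail k w = (\<Sum>j. inverse (fact (j + Suc k)) * w ^ j)"

lemma summable_exp_tail: "summable (\<lambda>j. inverse (fact (j + Suc k)) * w ^ j :: complex)"
proof (rule summable_comparison_test')
  show "summable (\<lambda>j. inverse (fact j) * norm w ^ j :: real)" by (rule summable_exp)
  fix j
  have "fact j \<le> (fact (j + Suc k) :: real)" by (rule fact_mono) simp
  then have "inverse (fact (j + Suc k)) \<le> (inverse (fact j) :: real)" by (intro le_imp_inverse_le) simp_all
  then show "norm (inverse (fact (j + Suc k)) * w ^ j) \<le> inverse (fact j) * norm w ^ j"
    by (simp add: norm_mult norm_power norm_inverse mult_right_mono del: fact_Suc add_Suc_right)
qed

lemma isCont_exp_tail: "isCont (exp_tail k) w"
  unfolding exp_tail_def[abs_def] by (intro isCont_powser_converges_everywhere summable_exp_tail)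

lemma exp_tail_0: "exp_tail k 0 = inverse (fact (Suc k))"
  unfolding exp_tail_def by (subst powser_zero) simp

lemma exp_tail_split: "exp_tail k w = inverse (fact (Suc k)) + w * exp_tail (Suc k) w"
  using powser_split_head(1)[OF summable_exp_tail[of k w]]
  by (simp add: exp_tail_def mult.commute)

lemma exp_eq_exp_tail: "exp w = 1 + w * exp_tail 0 w"
proof -
  have "exp w = (\<Sum>j. inverse (fact j) * w ^ j)"
    by (simp add: exp_def scaleR_conv_of_real)
  also have "\<dots> = 1 + w * exp_tail 0 w"
    using powser_split_head(1)[OF summable_exp[of w]] by (simp add: exp_tail_def mult.commute)
  finally show ?thesis .
qed

text \<open>\<open>input_resp s z = \<integral>\<^sub>0\<^sup>s exp (\<tau> z) d\<tau>\<close>, the response at time \<open>s\<close> of \<open>x' = z x + 1\<close>, \<open>x 0 = 0\<close>.\<close>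
definition input_resp :: "real \<Rightarrow> complex \<Rightarrow> complex" where
  "input_resp s z = of_real s * exp_tail 0 (of_real s * z)"

text \<open>Taylor expansion in \<open>s\<close>: up to a factorial, the coefficient of
  \<open>s ^ (j + 1)\<close> is \<open>z ^ j\<close>. This is how short step inputs reveal powers of
  the system matrix.\<close>

lemma input_resp_expand:
  "input_resp s z = (\<Sum>j<k. of_real (s ^ Suc j) * z ^ j / fact (Suc j))
     + of_real (s ^ Suc k) * z ^ k * exp_tail k (of_real s * z)"
proof (induction k)
  case 0
  show ?case by (simp add: input_resp_def)
next
  case (Suc k)
  have "of_real (s ^ Suc k) * z ^ k * exp_tail k (of_real s * z)
      = of_real (s ^ Suc k) * z ^ k / fact (Suc k)
        + of_real (s ^ Suc (Suc k)) * z ^ Suc k * exp_tail (Suc k) (of_real s * z)"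
    by (subst exp_tail_split) (simp add: algebra_simps inverse_eq_divide del: fact_Suc)
  then show ?case using Suc by (simp del: fact_Suc)
qed

text \<open>Both sides are the time derivative of the response: the left by its differential
  equation, the right by differentiating the integral.\<close>

lemma input_resp_exp: "z * input_resp s z + 1 = exp (of_real s * z)"
  unfolding exp_eq_exp_tail by (simp add: input_resp_def)

lemma input_resp_0 [simp]: "input_resp 0 z = 0"
  by (simp add: input_resp_def)

lemma has_vector_derivative_input_resp:
  "((\<lambda>s. input_resp s z) has_vector_derivative (z * input_resp s z + 1)) (at s within S)"
proof (cases "z = 0")
  case True
  then have "input_resp s z = of_real s" for s by (simp add: input_resp_def exp_tail_0)
  then show ?thesis
    using True by (auto intro!: derivative_eq_intros)
next
  case False
  then have eq: "input_resp s z = (exp (s *\<^sub>R z) - 1) / z" for s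
    using input_resp_exp[of z s] by (simp add: field_simps scaleR_conv_of_real)
  have "((\<lambda>s. exp (s *\<^sub>R z) - 1) has_vector_derivative exp (s *\<^sub>R z) * z - 0) (at s within S)"
    by (intro has_vector_derivative_diff exp_scaleR_has_vector_derivative_right has_vector_derivative_const)
  from bounded_linear.has_vector_derivative[OF bounded_linear_divide this, of z]
  show ?thesis
    unfolding input_resp_exp unfolding eq using False by (simp add: scaleR_conv_of_real)
qed

lemma isCont_input_resp: "isCont (input_resp s) z"
  unfolding input_resp_def[abs_def]
  by (intro continuous_intros isCont_o2[OF _ isCont_exp_tail])

lemma continuous_on_input_resp:
  "continuous_on K g \<Longrightarrow> continuous_on K (\<lambda>x. input_resp s (g x))"
  by (rule continuous_on_compose2[OF continuous_at_imp_continuous_on[of UNIV]])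
     (auto intro: isCont_input_resp)

text \<open>For a rate function \<open>z\<close> and input profiles \<open>Z j\<close>, an entry \<open>(c, s, j)\<close> stands for the control
  that has the value \<open>c\<close> in channel \<open>j\<close> during the last \<open>s\<close> time units.\<close>
definition step_resp ::
  "('i \<Rightarrow> 'a \<Rightarrow> complex) \<Rightarrow> (nat \<Rightarrow> 'i \<Rightarrow> 'a \<Rightarrow> complex) \<Rightarrow> (real \<times> real \<times> nat) list \<Rightarrow> 'i \<Rightarrow> 'a \<Rightarrow> real" where
  "step_resp z Z xs i x = (\<Sum>(c, s, j)\<leftarrow>xs. c * Re (input_resp s (z i x) * Z j i x))"

text \<open>Membership in the uniform closure of the step responses. Durations stay in
  \<open>{0..1}\<close> so that every combination fits into the time horizon 1 of
  \<open>exists_step_control\<close>.\<close>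

definition step_approximable ::
  "'a set \<Rightarrow> 'i set \<Rightarrow> nat \<Rightarrow> ('i \<Rightarrow> 'a \<Rightarrow> complex) \<Rightarrow> (nat \<Rightarrow> 'i \<Rightarrow> 'a \<Rightarrow> complex) \<Rightarrow> ('i \<Rightarrow> 'a \<Rightarrow> real) \<Rightarrow> bool" where
  "step_approximable K I m z Z F \<longleftrightarrow> (\<forall>\<epsilon>>0. \<exists>xs. set xs \<subseteq> UNIV \<times> {0..1} \<times> {..<m} \<and>
     (\<forall>i\<in>I. \<forall>x\<in>K. \<bar>F i x - step_resp z Z xs i x\<bar> < \<epsilon>))"

lemma step_approximable_resp:
  assumes "set xs \<subseteq> UNIV \<times> {0..1} \<times> {..<m}"
  shows "step_approximable K I m z Z (step_resp z Z xs)"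
  unfolding step_approximable_def using assms by auto

lemma step_approximable_zero: "step_approximable K I m z Z (\<lambda>i x. 0)"
  unfolding step_approximable_def by (auto intro!: exI[of _ "[]"] simp: step_resp_def)

lemma step_approximable_add:
  assumes "step_approximable K I m z Z F" "step_approximable K I m z Z G"
  shows "step_approximable K I m z Z (\<lambda>i x. F i x + G i x)"
  unfolding step_approximable_def
proof (intro allI impI)
  fix \<epsilon> :: real assume "\<epsilon> > 0"
  then have \<epsilon>: "\<epsilon> / 2 > 0" by simp
  obtain xs where xs: "set xs \<subseteq> UNIV \<times> {0..1} \<times> {..<m}"
      "\<forall>i\<in>I. \<forall>x\<in>K. \<bar>F i x - step_resp z Z xs i x\<bar> < \<epsilon> / 2"
    using assms(1) \<epsilon> unfolding step_approximable_def by blast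
  obtain ys where ys: "set ys \<subseteq> UNIV \<times> {0..1} \<times> {..<m}"
      "\<forall>i\<in>I. \<forall>x\<in>K. \<bar>G i x - step_resp z Z ys i x\<bar> < \<epsilon> / 2"
    using assms(2) \<epsilon> unfolding step_approximable_def by blast
  have "step_resp z Z (xs @ ys) i x = step_resp z Z xs i x + step_resp z Z ys i x" for i x
    by (simp add: step_resp_def)
  moreover have "\<bar>F i x + G i x - (step_resp z Z xs i x + step_resp z Z ys i x)\<bar> < \<epsilon>"
    if "i \<in> I" "x \<in> K" for i x
    using bspec[OF bspec[OF xs(2) that(1)] that(2)] bspec[OF bspec[OF ys(2) that(1)] that(2)] by linarith
  ultimately show "\<exists>xs. set xs \<subseteq> UNIV \<times> {0..1} \<times> {..<m} \<and>
     (\<forall>i\<in>I. \<forall>x\<in>K. \<bar>F i x + G i x - step_resp z Z xs i x\<bar> < \<epsilon>)"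
    using xs(1) ys(1) by (intro exI[of _ "xs @ ys"]) simp
qed

lemma step_approximable_scale:
  assumes "step_approximable K I m z Z F"
  shows "step_approximable K I m z Z (\<lambda>i x. a * F i x)"
  unfolding step_approximable_def
proof (intro allI impI)
  fix \<epsilon> :: real assume "\<epsilon> > 0"
  then have "\<epsilon> / (\<bar>a\<bar> + 1) > 0" by simp
  then obtain xs where xs: "set xs \<subseteq> UNIV \<times> {0..1} \<times> {..<m}"
      "\<forall>i\<in>I. \<forall>x\<in>K. \<bar>F i x - step_resp z Z xs i x\<bar> < \<epsilon> / (\<bar>a\<bar> + 1)"
    using assms unfolding step_approximable_def by blast
  define ys where "ys = map (\<lambda>(c, s, j). (a * c, s, j)) xs"
  have "step_resp z Z ys i x = a * step_resp z Z xs i x" for i x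
    by (simp add: step_resp_def ys_def o_def split_def sum_list_const_mult[symmetric] mult.assoc)
  moreover have "\<bar>a * F i x - a * step_resp z Z xs i x\<bar> < \<epsilon>" if "i \<in> I" "x \<in> K" for i x
  proof -
    have "\<bar>a * F i x - a * step_resp z Z xs i x\<bar> = \<bar>a\<bar> * \<bar>F i x - step_resp z Z xs i x\<bar>"
      by (simp add: abs_mult[symmetric] right_diff_distrib)
    also have "\<dots> \<le> \<bar>a\<bar> * (\<epsilon> / (\<bar>a\<bar> + 1))"
      using bspec[OF bspec[OF xs(2) that(1)] that(2)] by (intro mult_left_mono) auto
    also have "\<dots> < \<epsilon>" using \<open>\<epsilon> > 0\<close> by (simp add: field_simps)
    finally show ?thesis .
  qed
  moreover have "set ys \<subseteq> UNIV \<times> {0..1} \<times> {..<m}" using xs(1) by (force simp: ys_def)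
  ultimately show "\<exists>xs. set xs \<subseteq> UNIV \<times> {0..1} \<times> {..<m} \<and>
     (\<forall>i\<in>I. \<forall>x\<in>K. \<bar>a * F i x - step_resp z Z xs i x\<bar> < \<epsilon>)"
    by (intro exI[of _ ys]) simp
qed

lemma step_approximable_closed:
  assumes "\<And>\<epsilon>. \<epsilon> > 0 \<Longrightarrow> \<exists>G. step_approximable K I m z Z G \<and> (\<forall>i\<in>I. \<forall>x\<in>K. \<bar>F i x - G i x\<bar> < \<epsilon>)"
  shows "step_approximable K I m z Z F"
  unfolding step_approximable_def
proof (intro allI impI)
  fix \<epsilon> :: real assume "\<epsilon> > 0"
  then have \<epsilon>: "\<epsilon> / 2 > 0" by simp
  obtain G where G: "step_approximable K I m z Z G" "\<forall>i\<in>I. \<forall>x\<in>K. \<bar>F i x - G i x\<bar> < \<epsilon> / 2"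
    using assms[OF \<epsilon>] by blast
  obtain xs where xs: "set xs \<subseteq> UNIV \<times> {0..1} \<times> {..<m}"
      "\<forall>i\<in>I. \<forall>x\<in>K. \<bar>G i x - step_resp z Z xs i x\<bar> < \<epsilon> / 2"
    using G(1) \<epsilon> unfolding step_approximable_def by blast
  have "\<bar>F i x - step_resp z Z xs i x\<bar> < \<epsilon>" if "i \<in> I" "x \<in> K" for i x
    using bspec[OF bspec[OF xs(2) that(1)] that(2)] bspec[OF bspec[OF G(2) that(1)] that(2)] by linarith
  then show "\<exists>xs. set xs \<subseteq> UNIV \<times> {0..1} \<times> {..<m} \<and>
     (\<forall>i\<in>I. \<forall>x\<in>K. \<bar>F i x - step_resp z Z xs i x\<bar> < \<epsilon>)"
    using xs(1) by blast
qed

text \<open>Subtracting from the response over a short time \<open>s\<close> its Taylor terms of order below \<open>k\<close>, which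
  are approximable by induction, and rescaling by \<open>(k + 1)! / s ^ (k + 1)\<close> leaves \<open>z ^ k * Z j\<close>
  as \<open>s\<close> tends to \<open>0\<close>.\<close>
lemma step_approximable_power:
  assumes j: "j < m"
    and z: "\<And>i x. i \<in> I \<Longrightarrow> x \<in> K \<Longrightarrow> norm (z i x) \<le> M"
    and Z: "\<And>i x. i \<in> I \<Longrightarrow> x \<in> K \<Longrightarrow> norm (Z j i x) \<le> M"
  shows "step_approximable K I m z Z (\<lambda>i x. Re (z i x ^ k * Z j i x))"
proof (induction k rule: less_induct)
  case (less k)
  define M' where "M' = max M 1"
  have M': "M' \<ge> 1" "M \<le> M'" by (auto simp: M'_def)
  show ?case
  proof (rule step_approximable_closed)
    fix \<epsilon> :: real assume "\<epsilon> > 0"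
    \<comment> \<open>\<open>M' ^ Suc k\<close> bounds the norm of
      \<open>z i x ^ k * Z j i x\<close>; the factor 2 makes the final estimate strict.\<close>
    define \<eta> where "\<eta> = \<epsilon> / (2 * M' ^ Suc k)"
    have \<eta>: "\<eta> > 0" using \<open>\<epsilon> > 0\<close> M' by (simp add: \<eta>_def)
    have "isCont (\<lambda>w. fact (Suc k) * exp_tail k w) 0"
      by (intro continuous_intros isCont_exp_tail)
    then obtain \<delta> where \<delta>: "\<delta> > 0"
        "\<And>w. norm w < \<delta> \<Longrightarrow> norm (fact (Suc k) * exp_tail k w - 1) < \<eta>"
      using \<eta> unfolding continuous_at_eps_delta
      by (auto simp: dist_norm exp_tail_0 simp del: fact_Suc)
    \<comment> \<open>Short enough that \<open>s * z i x\<close> stays where the rescaled Taylor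
      remainder is within \<eta> of 1, its value at 0; at most 1, to be an admissible
      duration.\<close>
    define s where "s = min 1 (\<delta> / (2 * M'))"
    have s: "s > 0" "s \<le> 1" using \<delta>(1) M' by (auto simp: s_def)
    have sM: "s * M' < \<delta>"
    proof -
      have "s * M' \<le> \<delta> / (2 * M') * M'" using M' by (intro mult_right_mono) (auto simp: s_def)
      also have "\<dots> < \<delta>" using M' \<delta>(1) by simp
      finally show ?thesis .
    qed
    define a where "a = fact (Suc k) / s ^ Suc k"
    define G where "G i x = a * (step_resp z Z [(1, s, j)] i x
        + (\<Sum>l<k. (- (s ^ Suc l / fact (Suc l))) * Re (z i x ^ l * Z j i x)))" for i x
    have "step_approximable K I m z Z (\<lambda>i x. \<Sum>l<k'. (- (s ^ Suc l / fact (Suc l))) * Re (z i x ^ l * Z j i x))"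
      if "k' \<le> k" for k'
      using that
    proof (induction k')
      case 0
      then show ?case by (simp add: step_approximable_zero)
    next
      case (Suc k')
      then show ?case
        unfolding sum.lessThan_Suc
        by (intro step_approximable_add step_approximable_scale less) auto
    qed
    moreover have "step_approximable K I m z Z (\<lambda>i x. step_resp z Z [(1, s, j)] i x)"
      by (rule step_approximable_resp) (use s j in auto)
    ultimately have G: "step_approximable K I m z Z G"
      unfolding G_def by (intro step_approximable_scale step_approximable_add) auto
    \<comment> \<open>The subtracted terms cancel the Taylor polynomial exactly, so \<open>G\<close>
      is the rescaled remainder itself.\<close>
    have G_eq: "G i x = Re (fact (Suc k) * exp_tail k (of_real s * z i x) * (z i x ^ k * Z j i x))" for i x
    proof -
      define T where "T = of_real (s ^ Suc k) * z i x ^ k * exp_tail k (of_real s * z i x) * Z j i x"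
      have "step_resp z Z [(1, s, j)] i x
          = Re (((\<Sum>l<k. of_real (s ^ Suc l) * z i x ^ l / fact (Suc l))) * Z j i x + T)"
        unfolding T_def distrib_right[symmetric] input_resp_expand[of s "z i x" k, symmetric]
        by (simp add: step_resp_def)
      also have "\<dots> = (\<Sum>l<k. Re (of_real (s ^ Suc l / fact (Suc l)) * (z i x ^ l * Z j i x))) + Re T"
        unfolding sum_distrib_right Re_sum plus_complex.sel
        by (intro arg_cong2[of _ _ _ _ "(+)"] sum.cong refl arg_cong[of _ _ Re]) (simp del: fact_Suc)
      also have "\<dots> = (\<Sum>l<k. s ^ Suc l / fact (Suc l) * Re (z i x ^ l * Z j i x)) + Re T"
        by (simp only: Re_complex_of_real times_complex.sel Im_complex_of_real) simp
      finally have "G i x = a * Re T"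
        unfolding G_def by (simp add: sum_negf del: fact_Suc)
      also have "\<dots> = Re (of_real a * T)" by simp
      also have "of_real a * T = fact (Suc k) * exp_tail k (of_real s * z i x) * (z i x ^ k * Z j i x)"
        using s by (simp add: a_def T_def del: fact_Suc)
      finally show ?thesis .
    qed
    have "\<bar>Re (z i x ^ k * Z j i x) - G i x\<bar> < \<epsilon>" if i: "i \<in> I" and x: "x \<in> K" for i x
    proof -
      define u where "u = fact (Suc k) * exp_tail k (of_real s * z i x)"
      define v where "v = z i x ^ k * Z j i x"
      have "norm (z i x) \<le> M'" "norm (Z j i x) \<le> M'" using z[OF i x] Z[OF i x] M' by auto
      then have v: "norm v \<le> M' ^ Suc k"
        unfolding v_def norm_mult norm_power power_Suc2 using M'
        by (intro mult_mono power_mono) auto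
      have "norm (of_real s * z i x) \<le> s * M'"
        using \<open>norm (z i x) \<le> M'\<close> s by (simp add: norm_mult mult_left_mono)
      then have u: "norm (u - 1) < \<eta>" unfolding u_def using sM \<delta>(2) by simp
      have "Re (z i x ^ k * Z j i x) - G i x = Re (v - u * v)"
        unfolding G_eq u_def v_def by simp
      also have "\<bar>\<dots>\<bar> \<le> norm (v - u * v)" by (rule abs_Re_le_cmod)
      also have "v - u * v = - (u - 1) * v" by (simp add: algebra_simps)
      also have "norm \<dots> = norm (u - 1) * norm v" by (simp add: norm_mult norm_minus_commute)
      also have "\<dots> \<le> \<eta> * M' ^ Suc k" using u v \<eta> by (intro mult_mono) auto
      also have "\<dots> < \<epsilon>" using \<open>\<epsilon> > 0\<close> M' by (simp add: \<eta>_def)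
      finally show ?thesis .
    qed
    then show "\<exists>G. step_approximable K I m z Z G \<and> (\<forall>i\<in>I. \<forall>x\<in>K. \<bar>Re (z i x ^ k * Z j i x) - G i x\<bar> < \<epsilon>)"
      using G by blast
  qed
qed

section \<open>The span of the controlled directions\<close>

lemma fun_span_cong:
  assumes "f \<in> fun_span K n S" "\<And>x. x \<in> K \<Longrightarrow> g x = f x"
  shows "g \<in> fun_span K n S"
  using assms by (simp add: fun_span_def)

lemma fun_span_carrier:
  assumes "f \<in> fun_span K n S" "x \<in> K"
  shows "f x \<in> carrier_vec n"
  using assms by (auto simp: fun_span_def)

lemma fun_span_zero: "(\<lambda>x. 0\<^sub>v n) \<in> fun_span K n S"
  unfolding fun_span_def by (auto intro!: exI[of _ "{}"] simp: zero_vec_def)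

lemma fun_span_base:
  assumes "g \<in> S" "\<And>x. x \<in> K \<Longrightarrow> g x \<in> carrier_vec n"
  shows "g \<in> fun_span K n S"
proof -
  have "\<forall>x\<in>K. g x = vec n (\<lambda>i. \<Sum>h\<in>{g}. 1 * h x $ i)" using assms(2) by auto
  then show ?thesis unfolding fun_span_def using assms(1)
    by (intro CollectI exI[of _ "{g}"] exI[of _ "\<lambda>_. 1"]) simp
qed

lemma fun_span_smult:
  assumes "f \<in> fun_span K n S"
  shows "(\<lambda>x. a \<cdot>\<^sub>v f x) \<in> fun_span K n S"
proof -
  obtain F c where F: "finite F" "F \<subseteq> S" "\<And>x. x \<in> K \<Longrightarrow> f x = vec n (\<lambda>i. \<Sum>g\<in>F. c g * g x $ i)"
    using assms unfolding fun_span_def by blast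
  have "\<forall>x\<in>K. a \<cdot>\<^sub>v f x = vec n (\<lambda>i. \<Sum>g\<in>F. (a * c g) * g x $ i)"
    using F(3) by (auto simp: sum_distrib_left mult.assoc)
  then show ?thesis unfolding fun_span_def using F(1,2)
    by (intro CollectI exI[of _ F] exI[of _ "\<lambda>g. a * c g"]) simp
qed

lemma fun_span_add:
  assumes "f \<in> fun_span K n S" "g \<in> fun_span K n S"
  shows "(\<lambda>x. f x + g x) \<in> fun_span K n S"
proof -
  obtain F c where F: "finite F" "F \<subseteq> S" "\<And>x. x \<in> K \<Longrightarrow> f x = vec n (\<lambda>i. \<Sum>g\<in>F. c g * g x $ i)"
    using assms(1) unfolding fun_span_def by blast
  obtain G d where G: "finite G" "G \<subseteq> S" "\<And>x. x \<in> K \<Longrightarrow> g x = vec n (\<lambda>i. \<Sum>g\<in>G. d g * g x $ i)"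
    using assms(2) unfolding fun_span_def by blast
  \<comment> \<open>A generator may occur in both combinations; its coefficients then add
    up.\<close>
  define e where "e h = (if h \<in> F then c h else 0) + (if h \<in> G then d h else 0)" for h
  have "(\<Sum>h\<in>F \<union> G. e h * h x $ i) = (\<Sum>h\<in>F. c h * h x $ i) + (\<Sum>h\<in>G. d h * h x $ i)" for x i
  proof -
    have "(\<Sum>h\<in>F \<union> G. e h * h x $ i) = (\<Sum>h\<in>F \<union> G. (if h \<in> F then c h * h x $ i else 0))
       + (\<Sum>h\<in>F \<union> G. (if h \<in> G then d h * h x $ i else 0))"
      unfolding sum.distrib[symmetric] by (intro sum.cong) (auto simp: e_def distrib_right)
    then show ?thesis
      using F(1) G(1) by (simp add: sum.inter_restrict[symmetric] Int_absorb1 Int_absorb2)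
  qed
  then have "\<forall>x\<in>K. f x + g x = vec n (\<lambda>i. \<Sum>h\<in>F \<union> G. e h * h x $ i)"
    using F(3) G(3) by auto
  then show ?thesis unfolding fun_span_def using F(1,2) G(1,2)
    by (intro CollectI exI[of _ "F \<union> G"] exI[of _ e]) simp
qed

text \<open>The case \<open>cong\<close> is there because \<open>fun_span\<close> looks only at
  values on \<open>K\<close>: a member need not literally be built from generators by sums and
  multiples.\<close>

lemma fun_span_induct [consumes 2, case_names cong zero add smult base]:
  assumes f: "f \<in> fun_span K n S"
    and S: "\<And>g x. g \<in> S \<Longrightarrow> x \<in> K \<Longrightarrow> g x \<in> carrier_vec n"
    and cong: "\<And>f g. P f \<Longrightarrow> (\<And>x. x \<in> K \<Longrightarrow> g x = f x) \<Longrightarrow> P g"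
    and zero: "P (\<lambda>x. 0\<^sub>v n)"
    and add: "\<And>f g. f \<in> fun_span K n S \<Longrightarrow> g \<in> fun_span K n S \<Longrightarrow> P f \<Longrightarrow> P g \<Longrightarrow> P (\<lambda>x. f x + g x)"
    and smult: "\<And>a f. f \<in> fun_span K n S \<Longrightarrow> P f \<Longrightarrow> P (\<lambda>x. a \<cdot>\<^sub>v f x)"
    and base: "\<And>g. g \<in> S \<Longrightarrow> P g"
  shows "P f"
proof -
  obtain F c where F: "finite F" "F \<subseteq> S" and feq: "\<And>x. x \<in> K \<Longrightarrow> f x = vec n (\<lambda>i. \<Sum>g\<in>F. c g * g x $ i)"
    using f unfolding fun_span_def by blast
  have "(\<lambda>x. vec n (\<lambda>i. \<Sum>g\<in>F. c g * g x $ i)) \<in> fun_span K n S \<and> P (\<lambda>x. vec n (\<lambda>i. \<Sum>g\<in>F. c g * g x $ i))"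
    using F
  proof (induction F rule: finite_induct)
    case empty
    have "(\<lambda>x. vec n (\<lambda>i. \<Sum>g\<in>{}. c g * g x $ i)) = (\<lambda>x. 0\<^sub>v n)" by (simp add: zero_vec_def)
    then show ?case using zero fun_span_zero[of n K S] by simp
  next
    case (insert h F)
    let ?f = "\<lambda>x. vec n (\<lambda>i. \<Sum>g\<in>F. c g * g x $ i)"
    have h: "h \<in> S" using insert by simp
    have hs: "h \<in> fun_span K n S" by (rule fun_span_base[OF h S[OF h]])
    have IH: "?f \<in> fun_span K n S" "P ?f" using insert by auto
    have eq: "vec n (\<lambda>i. \<Sum>g\<in>insert h F. c g * g x $ i) = c h \<cdot>\<^sub>v h x + ?f x" if "x \<in> K" for x
      using insert(1,2) carrier_vecD[OF S[OF h that]] by (intro eq_vecI) simp_all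
    have "P (\<lambda>x. c h \<cdot>\<^sub>v h x + ?f x)"
      by (intro add smult base fun_span_smult hs h IH)
    moreover have "(\<lambda>x. c h \<cdot>\<^sub>v h x + ?f x) \<in> fun_span K n S"
      by (intro fun_span_add fun_span_smult hs IH)
    ultimately show ?case
      by (intro conjI) (erule fun_span_cong cong, erule eq)+
  qed
  then show ?thesis by (elim conjE) (erule cong, erule feq)
qed

text \<open>\<open>A \<beta>\<close> acts on coordinates as \<open>v\<^sub>i \<mapsto> d\<^sub>i v\<^sub>i + e\<^sub>i v\<^bsub>\<sigma> i\<^esub>\<close>, with \<open>\<sigma>\<close> exchanging the two coordinates of a
  rotation block. Pairing a coordinate with its partner to \<open>v\<^sub>i + \<i> v\<^bsub>\<sigma> i\<^esub>\<close> turns this into multiplication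
  by the eigenvalue \<open>d\<^sub>i - \<i> e\<^sub>i\<close>, also for the one-dimensional blocks, where \<open>\<sigma> i = i\<close> and \<open>e\<^sub>i = 0\<close>.\<close>
locale block_ensemble =
  fixes K :: "real set" and n m :: nat
    and A :: "real \<Rightarrow> real mat" and b :: "nat \<Rightarrow> real \<Rightarrow> real vec"
    and d e :: "nat \<Rightarrow> real \<Rightarrow> real" and \<sigma> :: "nat \<Rightarrow> nat"
  assumes compact_K: "compact K"
    and A_carrier: "A \<beta> \<in> carrier_mat n n"
    and A_index: "v \<in> carrier_vec n \<Longrightarrow> i < n \<Longrightarrow> (A \<beta> *\<^sub>v v) $ i = d i \<beta> * v $ i + e i \<beta> * v $ \<sigma> i"
    and \<sigma>_less: "i < n \<Longrightarrow> \<sigma> i < n"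
    and \<sigma>_\<sigma>: "\<sigma> (\<sigma> i) = i"
    and d_\<sigma>: "d (\<sigma> i) = d i"
    and e_\<sigma>: "e (\<sigma> i) \<beta> = - e i \<beta>"
    and continuous_d: "i < n \<Longrightarrow> continuous_on K (d i)"
    and continuous_e: "i < n \<Longrightarrow> continuous_on K (e i)"
    and b_cont: "j < m \<Longrightarrow> b j \<in> cont_vec_fun K n"
begin

definition rate :: "nat \<Rightarrow> real \<Rightarrow> complex" where
  "rate i \<beta> = Complex (d i \<beta>) (- e i \<beta>)"

text \<open>Redundant by design: a rotation block yields two entries, tied together by
  \<open>paired_partner\<close>, and a one-dimensional block yields
  \<open>(1 + \<i>) * v $ i\<close>. In return all coordinates obey the same formula.\<close>

definition paired :: "real vec \<Rightarrow> nat \<Rightarrow> complex" where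
  "paired v i = Complex (v $ i) (v $ \<sigma> i)"

lemma b_carrier: "j < m \<Longrightarrow> \<beta> \<in> K \<Longrightarrow> b j \<beta> \<in> carrier_vec n"
  using b_cont by (auto simp: cont_vec_fun_def)

lemma mult_A_carrier [simp]: "A \<beta> *\<^sub>v v \<in> carrier_vec n"
  using mult_mat_vec_carrier[OF A_carrier] A_carrier by (metis carrier_matD(1) dim_mult_mat_vec carrier_vecI)

lemma pow_A_carrier: "A \<beta> ^\<^sub>m k \<in> carrier_mat n n"
  using A_carrier by simp

lemma mult_pow_A_carrier [simp]: "A \<beta> ^\<^sub>m k *\<^sub>v v \<in> carrier_vec n"
  using pow_A_carrier by (metis carrier_matD(1) dim_mult_mat_vec carrier_vecI)

lemma rate_\<sigma>: "rate (\<sigma> i) \<beta> = cnj (rate i \<beta>)"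
  by (simp add: rate_def d_\<sigma> e_\<sigma> complex_eq_iff)

lemma paired_mult_A:
  assumes "v \<in> carrier_vec n" "i < n"
  shows "paired (A \<beta> *\<^sub>v v) i = rate i \<beta> * paired v i"
  using assms by (simp add: paired_def rate_def A_index \<sigma>_less \<sigma>_\<sigma> d_\<sigma> e_\<sigma> complex_eq_iff)

text \<open>\<open>pow_mat\<close> appends the new factor on the right, whereas the induction over
  powers needs it on the left.\<close>

lemma pow_A_Suc_mult:
  assumes v: "v \<in> carrier_vec n"
  shows "A \<beta> ^\<^sub>m Suc k *\<^sub>v v = A \<beta> *\<^sub>v (A \<beta> ^\<^sub>m k *\<^sub>v v)"
  using assms
proof (induction k arbitrary: v)
  case 0
  then show ?case by (simp add: carrier_matD(1)[OF A_carrier] assoc_mult_mat_vec[OF _ A_carrier])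
next
  case (Suc k)
  have "A \<beta> ^\<^sub>m Suc (Suc k) *\<^sub>v v = A \<beta> ^\<^sub>m Suc k *\<^sub>v (A \<beta> *\<^sub>v v)"
    unfolding pow_mat.simps(2)[of _ "Suc k"]
    using assoc_mult_mat_vec[OF pow_A_carrier A_carrier Suc.prems] .
  also have "\<dots> = A \<beta> *\<^sub>v (A \<beta> ^\<^sub>m k *\<^sub>v (A \<beta> *\<^sub>v v))" by (rule Suc.IH) simp
  also have "A \<beta> ^\<^sub>m k *\<^sub>v (A \<beta> *\<^sub>v v) = A \<beta> ^\<^sub>m Suc k *\<^sub>v v"
    unfolding pow_mat.simps(2)
    using assoc_mult_mat_vec[OF pow_A_carrier A_carrier Suc.prems, symmetric] .
  finally show ?case .
qed

lemma paired_pow_A: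
  assumes "v \<in> carrier_vec n" "i < n"
  shows "paired (A \<beta> ^\<^sub>m k *\<^sub>v v) i = rate i \<beta> ^ k * paired v i"
proof (induction k)
  case 0
  have "A \<beta> ^\<^sub>m 0 *\<^sub>v v = v" using assms A_carrier[of \<beta>] by (auto simp: carrier_matD)
  then show ?case by simp
next
  case (Suc k)
  then show ?case using assms by (simp add: pow_A_Suc_mult paired_mult_A del: pow_mat.simps)
qed

text \<open>Real coordinates are real parts of paired ones, so questions about the controlled
  directions become questions about moments of scalar rates.\<close>

lemma pow_A_index:
  assumes "v \<in> carrier_vec n" "i < n"
  shows "(A \<beta> ^\<^sub>m k *\<^sub>v v) $ i = Re (rate i \<beta> ^ k * paired v i)"
  using arg_cong[OF paired_pow_A[OF assms, of \<beta> k], of Re] by (simp add: paired_def)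

lemma continuous_rate: "i < n \<Longrightarrow> continuous_on K (rate i)"
  unfolding rate_def[abs_def] by (intro continuous_intros continuous_d continuous_e)

lemma continuous_paired:
  assumes "f \<in> cont_vec_fun K n" "i < n"
  shows "continuous_on K (\<lambda>\<beta>. paired (f \<beta>) i)"
  using assms \<sigma>_less[OF assms(2)] unfolding paired_def cont_vec_fun_def
  by (auto intro!: continuous_intros)

abbreviation \<L> where "\<L> \<equiv> control_span K n m A b"

lemma control_span_base: "j < m \<Longrightarrow> (\<lambda>\<beta>. A \<beta> ^\<^sub>m k *\<^sub>v b j \<beta>) \<in> \<L>"
  unfolding control_span_def by (rule fun_span_base) auto

lemma control_span_induct [consumes 1, case_names cong zero add smult base]:
  assumes "f \<in> \<L>"
    and "\<And>f g. P f \<Longrightarrow> (\<And>\<beta>. \<beta> \<in> K \<Longrightarrow> g \<beta> = f \<beta>) \<Longrightarrow> P g"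
    and "P (\<lambda>\<beta>. 0\<^sub>v n)"
    and "\<And>f g. f \<in> \<L> \<Longrightarrow> g \<in> \<L> \<Longrightarrow> P f \<Longrightarrow> P g \<Longrightarrow> P (\<lambda>\<beta>. f \<beta> + g \<beta>)"
    and "\<And>a f. f \<in> \<L> \<Longrightarrow> P f \<Longrightarrow> P (\<lambda>\<beta>. a \<cdot>\<^sub>v f \<beta>)"
    and "\<And>k j. j < m \<Longrightarrow> P (\<lambda>\<beta>. A \<beta> ^\<^sub>m k *\<^sub>v b j \<beta>)"
  shows "P f"
proof (rule fun_span_induct[OF assms(1)[unfolded control_span_def]], goal_cases)
  case (1 g \<beta>)
  then show ?case by auto
next
  case (2 f g)
  then show ?case by (rule assms(2))
next
  case 3
  show ?case by (rule assms(3))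
next
  case (4 f g)
  then show ?case by (intro assms(4)) (simp_all add: control_span_def)
next
  case (5 a f)
  then show ?case by (intro assms(5)) (simp_all add: control_span_def)
next
  case (6 g)
  then show ?case using assms(6) by auto
qed

lemma control_span_carrier: "f \<in> \<L> \<Longrightarrow> \<beta> \<in> K \<Longrightarrow> f \<beta> \<in> carrier_vec n"
  unfolding control_span_def by (rule fun_span_carrier)

lemma control_span_cont: "f \<in> \<L> \<Longrightarrow> f \<in> cont_vec_fun K n"
proof (induction rule: control_span_induct)
  case (cong f g)
  then show ?case by (auto simp: cont_vec_fun_def cong: continuous_on_cong)
next
  case zero
  then show ?case by (simp add: cont_vec_fun_def)
next
  case (add f g)
  have "continuous_on K (\<lambda>\<beta>. (f \<beta> + g \<beta>) $ i) \<longleftrightarrow> continuous_on K (\<lambda>\<beta>. f \<beta> $ i + g \<beta> $ i)" if "i < n" for i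
    using add(4) that by (intro continuous_on_cong) (auto simp: cont_vec_fun_def)
  then show ?case using add by (auto simp: cont_vec_fun_def intro!: continuous_intros)
next
  case (smult a f)
  have "continuous_on K (\<lambda>\<beta>. (a \<cdot>\<^sub>v f \<beta>) $ i) \<longleftrightarrow> continuous_on K (\<lambda>\<beta>. a * f \<beta> $ i)" if "i < n" for i
    using smult(2) that by (intro continuous_on_cong) (auto simp: cont_vec_fun_def)
  then show ?case using smult by (auto simp: cont_vec_fun_def intro!: continuous_intros)
next
  case (base k j)
  have "continuous_on K (\<lambda>\<beta>. (A \<beta> ^\<^sub>m k *\<^sub>v b j \<beta>) $ i)
      \<longleftrightarrow> continuous_on K (\<lambda>\<beta>. Re (rate i \<beta> ^ k * paired (b j \<beta>) i))" if "i < n" for i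
    using b_carrier[OF base] that by (intro continuous_on_cong) (auto simp: pow_A_index)
  then show ?case
    unfolding cont_vec_fun_def
    by (auto intro!: continuous_intros continuous_rate continuous_paired b_cont[OF base])
qed

lemma control_span_mult_A: "f \<in> \<L> \<Longrightarrow> (\<lambda>\<beta>. A \<beta> *\<^sub>v f \<beta>) \<in> \<L>"
proof (induction rule: control_span_induct)
  case (cong f g)
  show ?case
    using cong(1) unfolding control_span_def by (rule fun_span_cong) (simp add: cong(2))
next
  case zero
  have "A \<beta> *\<^sub>v 0\<^sub>v n = 0\<^sub>v n" for \<beta>
    by (intro eq_vecI) (simp_all add: A_index \<sigma>_less carrier_matD[OF A_carrier] del: index_mult_mat_vec)
  then show ?case unfolding control_span_def using fun_span_zero by simp
next
  case (add f g)
  have "(\<lambda>\<beta>. A \<beta> *\<^sub>v f \<beta> + A \<beta> *\<^sub>v g \<beta>) \<in> \<L>"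
    using add(3,4) unfolding control_span_def by (rule fun_span_add)
  then show ?case unfolding control_span_def
    by (rule fun_span_cong)
       (use add(1,2) in \<open>auto simp: control_span_def dest!: fun_span_carrier intro!: mult_add_distrib_mat_vec[OF A_carrier]\<close>)
next
  case (smult a f)
  have "(\<lambda>\<beta>. a \<cdot>\<^sub>v (A \<beta> *\<^sub>v f \<beta>)) \<in> \<L>"
    using smult(2) unfolding control_span_def by (rule fun_span_smult)
  then show ?case unfolding control_span_def
    by (rule fun_span_cong)
       (use smult(1) in \<open>auto simp: control_span_def dest!: fun_span_carrier intro!: mult_mat_vec[OF A_carrier]\<close>)
next
  case (base k j)
  show ?case
    using control_span_base[OF base, of "Suc k"] unfolding control_span_def
    by (rule fun_span_cong) (simp add: b_carrier[OF base] pow_A_Suc_mult del: pow_mat.simps)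
qed

end

section \<open>Realisation of step responses by piecewise constant controls\<close>

lemma input_resp_closed_form: "input_resp s z = (if z = 0 then of_real s else (exp (of_real s * z) - 1) / z)"
proof (cases "z = 0")
  case True
  then show ?thesis by (simp add: input_resp_def exp_tail_0)
next
  case False
  then show ?thesis using input_resp_exp[of z s] by (simp add: field_simps)
qed

lemma exp_of_real_mult_cnj: "exp (of_real s * cnj z) = cnj (exp (of_real s * z))"
  by (simp add: exp_cnj)

lemma input_resp_cnj: "input_resp s (cnj z) = cnj (input_resp s z)"
  by (simp add: input_resp_closed_form exp_of_real_mult_cnj)

lemma continuous_on_input_resp_time: "continuous_on S (\<lambda>s. input_resp s z)"
  unfolding continuous_on_eq_continuous_within
  by (auto intro: has_vector_derivative_continuous has_vector_derivative_input_resp)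

text \<open>The input is switched on at \<tau>. There the one-sided derivatives are 0 and 1, so that
  time is excluded and becomes an exceptional time of the solution.\<close>

lemma has_vector_derivative_delayed_input_resp:
  assumes "t \<noteq> \<tau>"
  shows "((\<lambda>t. input_resp (max 0 (t - \<tau>)) z) has_vector_derivative
           (z * input_resp (max 0 (t - \<tau>)) z + (if \<tau> \<le> t then 1 else 0))) (at t within S)"
proof (cases "\<tau> \<le> t")
  case True
  then have "t \<in> {\<tau><..}" using assms by simp
  have "((\<lambda>t. t - \<tau>) has_vector_derivative 1) (at t)"
    by (auto intro!: derivative_eq_intros)
  from vector_diff_chain_at[OF this has_vector_derivative_input_resp[of z "t - \<tau>" UNIV]]
  have "((\<lambda>t. input_resp (t - \<tau>) z) has_vector_derivative (z * input_resp (t - \<tau>) z + 1)) (at t)"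
    by (simp add: o_def)
  then have "((\<lambda>t. input_resp (max 0 (t - \<tau>)) z) has_vector_derivative (z * input_resp (t - \<tau>) z + 1)) (at t)"
    by (rule has_vector_derivative_transform_within_open[OF _ open_greaterThan \<open>t \<in> {\<tau><..}\<close>]) simp
  then show ?thesis using True by (auto intro: has_vector_derivative_at_within)
next
  case False
  then have "t \<in> {..<\<tau>}" by simp
  have "((\<lambda>t. 0 :: complex) has_vector_derivative 0) (at t)" by (rule has_vector_derivative_const)
  then have "((\<lambda>t. input_resp (max 0 (t - \<tau>)) z) has_vector_derivative 0) (at t)"
    by (rule has_vector_derivative_transform_within_open[OF _ open_lessThan \<open>t \<in> {..<\<tau>}\<close>]) (simp add: max_def)
  then show ?thesis using False by (auto intro: has_vector_derivative_at_within)
qed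

text \<open>Sorting the exceptional times together with both end points gives the breakpoints; no
  exceptional time lies strictly between neighbours.\<close>

lemma piecewise_const_controlI:
  assumes D: "finite D" and "T > 0"
    and u: "\<And>t. t \<in> {0..T} \<Longrightarrow> u t \<in> carrier_vec m"
    and const: "\<And>a b. a < b \<Longrightarrow> {a<..<b} \<inter> D = {} \<Longrightarrow> \<exists>c. \<forall>t\<in>{a<..<b}. u t = c"
  shows "piecewise_const_control m T u"
proof -
  define E where "E = insert 0 (insert T (D \<inter> {0..T}))"
  have E: "finite E" "E \<subseteq> {0..T}" "0 \<in> E" "T \<in> E"
    using D \<open>T > 0\<close> by (auto simp: E_def)
  define xs where "xs = sorted_list_of_set E"
  have xs: "set xs = E" "sorted_wrt (<) xs"
    using E(1) by (simp_all add: xs_def)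
  have len: "length xs > 0" using xs(1) E(3) by (cases xs) auto
  have mono: "xs ! i < xs ! j" if "i < j" "j < length xs" for i j
    using xs(2) that by (simp add: sorted_wrt_iff_nth_less)
  have in_E: "xs ! i \<in> {0..T}" if "i < length xs" for i
    using xs(1) E(2) nth_mem[OF that] by blast
  have "xs ! 0 = 0"
  proof -
    obtain i where i: "i < length xs" "xs ! i = 0" using E(3) xs(1) by (metis in_set_conv_nth)
    show ?thesis using mono[of 0 i] i in_E[OF len] by (cases "i = 0") auto
  qed
  moreover have "xs ! (length xs - 1) = T"
  proof -
    obtain i where i: "i < length xs" "xs ! i = T" using E(4) xs(1) by (metis in_set_conv_nth)
    show ?thesis
    proof (cases "i = length xs - 1")
      case False
      then have "i < length xs - 1" using i(1) by simp
      then show ?thesis using mono[of i "length xs - 1"] i in_E[of "length xs - 1"] len by auto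
    qed (use i in simp)
  qed
  moreover have "xs ! i < xs ! Suc i \<and> (\<exists>c. \<forall>t\<in>{xs ! i<..<xs ! Suc i}. u t = c)" if "i < length xs - 1" for i
  proof
    show less: "xs ! i < xs ! Suc i" using that by (intro mono) auto
    have False if t: "t \<in> {xs ! i<..<xs ! Suc i}" "t \<in> D" for t
    proof -
      have "i < length xs" "Suc i < length xs" using \<open>i < length xs - 1\<close> by simp_all
      then have "t \<in> E" using t in_E[of i] in_E[of "Suc i"] by (simp add: E_def)
      then obtain k where k: "k < length xs" "xs ! k = t" using xs(1) by (metis in_set_conv_nth)
      consider "k < i" | "k = i" | "k = Suc i" | "Suc i < k" by linarith
      then show False
        using mono[of k i] mono[of "Suc i" k] k t \<open>i < length xs\<close> by cases auto
    qed
    then show "\<exists>c. \<forall>t\<in>{xs ! i<..<xs ! Suc i}. u t = c"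
      by (intro const less) blast
  qed
  ultimately show ?thesis
    unfolding piecewise_const_control_def using u
    by (intro conjI ballI exI[of _ "length xs - 1"] exI[of _ "\<lambda>i. xs ! i"]) auto
qed

lemma step_approximable_cong:
  assumes "step_approximable K I m z Z F" "\<And>i x. i \<in> I \<Longrightarrow> x \<in> K \<Longrightarrow> G i x = F i x"
  shows "step_approximable K I m z Z G"
  using assms unfolding step_approximable_def by simp

context block_ensemble
begin

abbreviation input_pair :: "nat \<Rightarrow> nat \<Rightarrow> real \<Rightarrow> complex" where
  "input_pair j i \<beta> \<equiv> paired (b j \<beta>) i"

lemma bounded_rate_input:
  "\<exists>M. (\<forall>i<n. \<forall>\<beta>\<in>K. norm (rate i \<beta>) \<le> M) \<and> (\<forall>j<m. \<forall>i<n. \<forall>\<beta>\<in>K. norm (input_pair j i \<beta>) \<le> M)"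
proof -
  have "compact ((\<Union>i<n. rate i ` K) \<union> (\<Union>j<m. \<Union>i<n. input_pair j i ` K))"
    by (intro compact_Un compact_UN compact_continuous_image continuous_rate continuous_paired b_cont compact_K) auto
  then have "bounded ((\<Union>i<n. rate i ` K) \<union> (\<Union>j<m. \<Union>i<n. input_pair j i ` K))"
    by (rule compact_imp_bounded)
  then obtain M where M: "\<forall>x\<in>(\<Union>i<n. rate i ` K) \<union> (\<Union>j<m. \<Union>i<n. input_pair j i ` K). norm x \<le> M"
    by (auto simp: bounded_iff)
  show ?thesis by (intro exI[of _ M] conjI allI impI ballI; rule bspec[OF M]; blast)
qed

text \<open>The passage from algebra to control: generators are moments, covered by
  \<open>step_approximable_power\<close>, and approximability survives linear combinations.\<close>

lemma control_span_step_approximable: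
  assumes "f \<in> \<L>"
  shows "step_approximable K {..<n} m rate input_pair (\<lambda>i \<beta>. f \<beta> $ i)"
  using assms
proof (induction rule: control_span_induct)
  case (cong f g)
  then show ?case by (auto intro: step_approximable_cong)
next
  case zero
  show ?case by (rule step_approximable_cong[OF step_approximable_zero]) simp
next
  case (add f g)
  show ?case
    by (rule step_approximable_cong[OF step_approximable_add[OF add(3,4)]])
       (use carrier_vecD[OF control_span_carrier[OF add(2)]] in simp)
next
  case (smult a f)
  show ?case
    by (rule step_approximable_cong[OF step_approximable_scale[OF smult(2), of a]])
       (use carrier_vecD[OF control_span_carrier[OF smult(1)]] in simp)
next
  case (base k j)
  obtain M where M: "\<forall>i<n. \<forall>\<beta>\<in>K. norm (rate i \<beta>) \<le> M"
    "\<forall>j<m. \<forall>i<n. \<forall>\<beta>\<in>K. norm (input_pair j i \<beta>) \<le> M"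
    using bounded_rate_input by blast
  have "step_approximable K {..<n} m rate input_pair (\<lambda>i \<beta>. Re (rate i \<beta> ^ k * input_pair j i \<beta>))"
    using base M by (intro step_approximable_power[where M = M]) auto
  then show ?case
    by (rule step_approximable_cong) (simp add: pow_A_index b_carrier[OF base])
qed

lemma paired_partner: "paired v (\<sigma> i) = \<i> * cnj (paired v i)"
  by (simp add: paired_def \<sigma>_\<sigma> complex_eq_iff)

text \<open>Superposition in each paired coordinate: the free evolution of \<open>X0\<close> plus
  one delayed response per list entry. An entry \<open>(c, s, j)\<close> acts during the last
  \<open>s\<close> time units, hence is switched on at \<open>1 - s\<close>, the \<tau> of the
  proof.\<close>

lemma exists_step_control:
  assumes xs: "set xs \<subseteq> UNIV \<times> {0..1} \<times> {..<m}" and X0: "X0 \<in> cont_vec_fun K n"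
  obtains u X where "piecewise_const_control m 1 u" "ensemble_solution K n m A b 1 u X"
    "\<And>\<beta>. \<beta> \<in> K \<Longrightarrow> X 0 \<beta> = X0 \<beta>"
    "\<And>\<beta>. X 1 \<beta> = vec n (\<lambda>i. Re (exp (rate i \<beta>) * paired (X0 \<beta>) i) + step_resp rate input_pair xs i \<beta>)"
proof -
  define p where "p = length xs"
  define c where "c k = fst (xs ! k)" for k
  define \<tau> where "\<tau> k = 1 - fst (snd (xs ! k))" for k
  define q where "q k = snd (snd (xs ! k))" for k
  have \<tau>: "\<tau> k \<in> {0..1}" and q: "q k < m" if "k < p" for k
    using subsetD[OF xs nth_mem, of k] that by (auto simp: \<tau>_def q_def p_def mem_Times_iff)
  define u where "u t = vec m (\<lambda>j. \<Sum>k<p. if q k = j \<and> \<tau> k \<le> t then c k else 0)" for t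
  define W where "W t i \<beta> = exp (of_real t * rate i \<beta>) * paired (X0 \<beta>) i
     + (\<Sum>k<p. of_real (c k) * (input_resp (max 0 (t - \<tau> k)) (rate i \<beta>) * input_pair (q k) i \<beta>))" for t i \<beta>
  define X where "X t \<beta> = vec n (\<lambda>i. Re (W t i \<beta>))" for t \<beta>
  \<comment> \<open>This symmetry characterises pairings of real vectors, so \<open>W t\<close> is
    the pairing of its own real parts \<open>X t\<close>.\<close>
  have W_\<sigma>: "W t (\<sigma> i) \<beta> = \<i> * cnj (W t i \<beta>)" for t i \<beta>
    by (simp add: W_def rate_\<sigma> paired_partner input_resp_cnj exp_of_real_mult_cnj sum_distrib_left algebra_simps)
  have paired_X: "paired (X t \<beta>) i = W t i \<beta>" if "i < n" for t \<beta> i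
    using that by (simp add: paired_def X_def \<sigma>_less W_\<sigma>)
  have control: "piecewise_const_control m 1 u"
  proof (rule piecewise_const_controlI[of "\<tau> ` {..<p}"])
    show "u t \<in> carrier_vec m" for t by (simp add: u_def)
    fix a b :: real assume ab: "a < b" "{a<..<b} \<inter> \<tau> ` {..<p} = {}"
    have "\<tau> k \<le> t \<longleftrightarrow> \<tau> k \<le> a" if "t \<in> {a<..<b}" "k < p" for t k
    proof -
      have "\<tau> k \<notin> {a<..<b}" using ab(2) that(2) by blast
      then show ?thesis using that(1) by auto
    qed
    then have "u t = u a" if "t \<in> {a<..<b}" for t
      unfolding u_def using that by (intro eq_vecI) (auto intro!: sum.cong)
    then show "\<exists>c. \<forall>t\<in>{a<..<b}. u t = c" by blast
  qed simp_all
  have X_cont: "X t \<in> cont_vec_fun K n" for t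
  proof -
    have "continuous_on K (\<lambda>\<beta>. Re (W t i \<beta>))" if i: "i < n" for i
      unfolding W_def
      by (intro continuous_intros continuous_on_input_resp continuous_rate continuous_paired X0 b_cont i)
         (use q in auto)
    then show ?thesis by (auto simp: cont_vec_fun_def X_def)
  qed
  have time_cont: "continuous_on {0..1} (\<lambda>t. X t \<beta> $ i)" if "i < n" for i \<beta>
  proof -
    have "continuous_on {0..1} (\<lambda>t. input_resp (max 0 (t - \<tau> k)) (rate i \<beta>))" for k
      by (rule continuous_on_compose2[OF continuous_on_input_resp_time[of UNIV]])
         (auto intro!: continuous_intros)
    then show ?thesis using that by (simp add: X_def W_def, intro continuous_intros)
  qed
  have deriv: "((\<lambda>s. X s \<beta> $ i) has_real_derivative
       (A \<beta> *\<^sub>v X t \<beta>) $ i + (\<Sum>j<m. b j \<beta> $ i * u t $ j)) (at t within {0..1})"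
    if t: "t \<in> {0..1} - \<tau> ` {..<p}" and i: "i < n" for t \<beta> i
  proof -
    define z where "z = rate i \<beta>"
    define on where "on k = (if \<tau> k \<le> t then 1 else 0 :: complex)" for k
    have d0: "((\<lambda>t. exp (of_real t * z)) has_vector_derivative (exp (of_real t * z) * z)) (at t within {0..1})"
      using exp_scaleR_has_vector_derivative_right[of z t "{0..1}"] by (simp add: scaleR_conv_of_real)
    have dk: "((\<lambda>t. input_resp (max 0 (t - \<tau> k)) z) has_vector_derivative
           (z * input_resp (max 0 (t - \<tau> k)) z + on k)) (at t within {0..1})" if "k < p" for k
      unfolding on_def using t that by (intro has_vector_derivative_delayed_input_resp) auto
    have "((\<lambda>t. W t i \<beta>) has_vector_derivative
       (exp (of_real t * z) * z) * paired (X0 \<beta>) i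
       + (\<Sum>k<p. of_real (c k) * ((z * input_resp (max 0 (t - \<tau> k)) z + on k) * input_pair (q k) i \<beta>)))
       (at t within {0..1})"
      unfolding W_def z_def[symmetric]
      by (intro has_vector_derivative_add has_vector_derivative_sum has_vector_derivative_mult_left
          has_vector_derivative_mult_right d0 dk) auto
    moreover have "(exp (of_real t * z) * z) * paired (X0 \<beta>) i
       + (\<Sum>k<p. of_real (c k) * ((z * input_resp (max 0 (t - \<tau> k)) z + on k) * input_pair (q k) i \<beta>))
       = z * W t i \<beta> + (\<Sum>k<p. of_real (c k) * on k * input_pair (q k) i \<beta>)"
      unfolding W_def z_def[symmetric]
      by (simp add: algebra_simps sum.distrib sum_distrib_left)
    ultimately have "((\<lambda>t. W t i \<beta>) has_vector_derivative
       (z * W t i \<beta> + (\<Sum>k<p. of_real (c k) * on k * input_pair (q k) i \<beta>))) (at t within {0..1})"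
      by (simp only:)
    from bounded_linear.has_vector_derivative[OF bounded_linear_Re this]
    have "((\<lambda>t. Re (W t i \<beta>)) has_vector_derivative
       Re (z * W t i \<beta> + (\<Sum>k<p. of_real (c k) * on k * input_pair (q k) i \<beta>))) (at t within {0..1})"
      .
    moreover have "Re (z * W t i \<beta>) = (A \<beta> *\<^sub>v X t \<beta>) $ i"
    proof -
      have "(A \<beta> *\<^sub>v X t \<beta>) $ i = Re (paired (A \<beta> *\<^sub>v X t \<beta>) i)" by (simp add: paired_def)
      also have "paired (A \<beta> *\<^sub>v X t \<beta>) i = z * W t i \<beta>"
        using paired_mult_A[of "X t \<beta>" i \<beta>] paired_X[OF i] i by (simp add: z_def X_def)
      finally show ?thesis by simp
    qed
    moreover have "Re (\<Sum>k<p. of_real (c k) * on k * input_pair (q k) i \<beta>) = (\<Sum>j<m. b j \<beta> $ i * u t $ j)"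
    proof -
      have "(\<Sum>j<m. b j \<beta> $ i * u t $ j)
          = (\<Sum>j<m. \<Sum>k<p. if q k = j then (if \<tau> k \<le> t then c k * b j \<beta> $ i else 0) else 0)"
        unfolding u_def by (simp add: sum_distrib_left) (intro sum.cong refl, auto)
      also have "\<dots> = (\<Sum>k<p. \<Sum>j<m. if q k = j then (if \<tau> k \<le> t then c k * b j \<beta> $ i else 0) else 0)"
        by (rule sum.swap)
      also have "\<dots> = (\<Sum>k<p. if \<tau> k \<le> t then c k * b (q k) \<beta> $ i else 0)"
        using q by (intro sum.cong) (auto simp: sum.delta')
      also have "\<dots> = Re (\<Sum>k<p. of_real (c k) * on k * input_pair (q k) i \<beta>)"
        unfolding Re_sum by (intro sum.cong) (auto simp: on_def paired_def)
      finally show ?thesis by simp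
    qed
    ultimately show ?thesis
      using i unfolding X_def has_real_derivative_iff_has_vector_derivative plus_complex.sel(1)
      by (simp only: index_vec)
  qed
  have sol: "ensemble_solution K n m A b 1 u X"
    unfolding ensemble_solution_def
    using X_cont time_cont deriv by (intro conjI exI[of _ "\<tau> ` {..<p}"]) auto
  have start: "X 0 \<beta> = X0 \<beta>" if "\<beta> \<in> K" for \<beta>
  proof -
    have "X0 \<beta> \<in> carrier_vec n" using X0 that by (auto simp: cont_vec_fun_def)
    \<comment> \<open>No step starts before time 0, so all delayed responses vanish there.\<close>
    moreover have "max 0 (- \<tau> k) = 0" if "k < p" for k using \<tau>[OF that] by simp
    ultimately show ?thesis
      by (intro eq_vecI) (auto simp: X_def W_def paired_def)
  qed
  have final: "X 1 \<beta> = vec n (\<lambda>i. Re (exp (rate i \<beta>) * paired (X0 \<beta>) i) + step_resp rate input_pair xs i \<beta>)" for \<beta>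
  proof -
    have "step_resp rate input_pair xs i \<beta>
       = (\<Sum>k<p. Re (of_real (c k) * (input_resp (max 0 (1 - \<tau> k)) (rate i \<beta>) * input_pair (q k) i \<beta>)))" for i
    proof -
      have "step_resp rate input_pair xs i \<beta> = (\<Sum>x\<leftarrow>xs. fst x * Re (input_resp (fst (snd x)) (rate i \<beta>)
          * input_pair (snd (snd x)) i \<beta>))"
        by (simp only: step_resp_def split_def)
      also have "\<dots> = (\<Sum>k<p. Re (of_real (c k) * (input_resp (max 0 (1 - \<tau> k)) (rate i \<beta>) * input_pair (q k) i \<beta>)))"
        unfolding sum_list_sum_nth length_map atLeast0LessThan p_def[symmetric]
      proof (intro sum.cong refl)
        fix k assume "k \<in> {..<p}"
        then have k: "k < length xs" "max 0 (1 - \<tau> k) = fst (snd (xs ! k))"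
          using \<tau>[of k] by (auto simp: \<tau>_def p_def)
        show "map (\<lambda>x. fst x * Re (input_resp (fst (snd x)) (rate i \<beta>) * input_pair (snd (snd x)) i \<beta>)) xs ! k
           = Re (of_real (c k) * (input_resp (max 0 (1 - \<tau> k)) (rate i \<beta>) * input_pair (q k) i \<beta>))"
          unfolding k(2) nth_map[OF k(1)] by (simp add: c_def q_def)
      qed
      finally show ?thesis .
    qed
    then show ?thesis by (simp add: X_def W_def)
  qed
  show ?thesis by (rule that[OF control sol start final])
qed

end

section \<open>Sufficiency of the rank condition\<close>

context block_ensemble
begin

text \<open>Half the sum of \<open>A\<close> and \<open>A'\<close> multiplies by \<open>d\<close>.
  Half their difference multiplies by \<open>e\<close> but exchanges partners, so it becomes a
  multiplication only when applied twice. This makes \<open>(d, e\<^sup>2)\<close> the map to which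
  the module theorem applies.\<close>

lemma control_span_dense:
  assumes A'_carrier: "\<And>\<beta>. A' \<beta> \<in> carrier_mat n n"
    and A'_index: "\<And>\<beta> v i. v \<in> carrier_vec n \<Longrightarrow> i < n \<Longrightarrow> (A' \<beta> *\<^sub>v v) $ i = d i \<beta> * v $ i - e i \<beta> * v $ \<sigma> i"
    and inv: "\<And>f. f \<in> \<L> \<Longrightarrow> (\<lambda>\<beta>. A' \<beta> *\<^sub>v f \<beta>) \<in> \<L>"
    and fibre: "\<And>y (h :: nat \<Rightarrow> real \<Rightarrow> real). \<exists>f\<in>\<L>. \<forall>i<n. \<forall>\<beta>\<in>K. (d i \<beta>, (e i \<beta>)\<^sup>2) = y \<longrightarrow> f \<beta> $ i = h i \<beta>"
    and g: "\<And>i. i < n \<Longrightarrow> continuous_on K (g i)" and "\<epsilon> > 0"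
  shows "\<exists>f\<in>\<L>. \<forall>i<n. \<forall>\<beta>\<in>K. \<bar>f \<beta> $ i - g i \<beta>\<bar> < \<epsilon>"
proof -
  define L where "L = {F :: nat \<Rightarrow> real \<Rightarrow> real. (\<lambda>\<beta>. vec n (\<lambda>i. F i \<beta>)) \<in> \<L>}"
  have L_cong: "G \<in> L" if "F \<in> L" "\<And>i \<beta>. i < n \<Longrightarrow> \<beta> \<in> K \<Longrightarrow> G i \<beta> = F i \<beta>" for F G
  proof -
    have "vec n (\<lambda>i. G i \<beta>) = vec n (\<lambda>i. F i \<beta>)" if "\<beta> \<in> K" for \<beta>
      using \<open>\<And>i \<beta>. i < n \<Longrightarrow> \<beta> \<in> K \<Longrightarrow> G i \<beta> = F i \<beta>\<close> that by (intro eq_vecI) simp_all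
    then show ?thesis
      using that(1) unfolding L_def control_span_def by (auto elim: fun_span_cong)
  qed
  have L_of: "(\<lambda>i \<beta>. f \<beta> $ i) \<in> L" if f: "f \<in> \<L>" for f
  proof -
    have "vec n (\<lambda>i. f \<beta> $ i) = f \<beta>" if "\<beta> \<in> K" for \<beta>
      using control_span_carrier[OF f that] by (intro eq_vecI) simp_all
    then show ?thesis
      using f unfolding L_def control_span_def by (auto elim: fun_span_cong)
  qed
  have L_add: "(\<lambda>i \<beta>. F i \<beta> + G i \<beta>) \<in> L" if "F \<in> L" "G \<in> L" for F G
  proof -
    have "(\<lambda>\<beta>. vec n (\<lambda>i. F i \<beta>) + vec n (\<lambda>i. G i \<beta>)) \<in> \<L>"
      using that unfolding L_def control_span_def mem_Collect_eq by (rule fun_span_add)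
    from L_of[OF this] show ?thesis by (rule L_cong) simp
  qed
  have L_scale: "(\<lambda>i \<beta>. a * F i \<beta>) \<in> L" if "F \<in> L" for a F
  proof -
    have "(\<lambda>\<beta>. a \<cdot>\<^sub>v vec n (\<lambda>i. F i \<beta>)) \<in> \<L>"
      using that unfolding L_def control_span_def mem_Collect_eq by (rule fun_span_smult)
    from L_of[OF this] show ?thesis by (rule L_cong) simp
  qed
  have L_A: "(\<lambda>i \<beta>. d i \<beta> * F i \<beta> + e i \<beta> * F (\<sigma> i) \<beta>) \<in> L" if "F \<in> L" for F
  proof -
    have "(\<lambda>\<beta>. A \<beta> *\<^sub>v vec n (\<lambda>i. F i \<beta>)) \<in> \<L>"
      using that unfolding L_def mem_Collect_eq by (rule control_span_mult_A)
    from L_of[OF this] show ?thesis by (rule L_cong) (simp add: A_index \<sigma>_less del: index_mult_mat_vec)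
  qed
  have L_A': "(\<lambda>i \<beta>. d i \<beta> * F i \<beta> - e i \<beta> * F (\<sigma> i) \<beta>) \<in> L" if "F \<in> L" for F
  proof -
    have "(\<lambda>\<beta>. A' \<beta> *\<^sub>v vec n (\<lambda>i. F i \<beta>)) \<in> \<L>"
      using that unfolding L_def mem_Collect_eq by (rule inv)
    from L_of[OF this] show ?thesis by (rule L_cong) (simp add: A'_index \<sigma>_less del: index_mult_mat_vec)
  qed
  have L_d: "(\<lambda>i \<beta>. d i \<beta> * F i \<beta>) \<in> L" if "F \<in> L" for F
    using L_scale[OF L_add[OF L_A[OF that] L_A'[OF that]], of "1/2"] by (rule L_cong) simp
  have L_e: "(\<lambda>i \<beta>. e i \<beta> * F (\<sigma> i) \<beta>) \<in> L" if "F \<in> L" for F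
    using L_scale[OF L_add[OF L_A[OF that] L_scale[OF L_A'[OF that], of "-1"]], of "1/2"]
    by (rule L_cong) simp
  \<comment> \<open>\<open>e\<close> changes sign at the partner, hence the factor -1.\<close>
  have L_e2: "(\<lambda>i \<beta>. (e i \<beta>)\<^sup>2 * F i \<beta>) \<in> L" if "F \<in> L" for F
    using L_scale[OF L_e[OF L_e[OF that]], of "-1"]
    by (rule L_cong) (simp add: \<sigma>_\<sigma> e_\<sigma> power2_eq_square)
  have L_poly: "(\<lambda>i \<beta>. p (d i \<beta>, (e i \<beta>)\<^sup>2) * F i \<beta>) \<in> L" if "F \<in> L" "real_polynomial_function p" for F p
    using that(2,1)
  proof (induction p arbitrary: F rule: real_polynomial_function.induct)
    case (linear p)
    note F = linear.prems
    interpret bounded_linear p by fact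
    have p: "p (x, y) = p (1, 0) * x + p (0, 1) * y" for x y
    proof -
      have "p (x, y) = p (x *\<^sub>R (1, 0) + y *\<^sub>R (0, 1))" by simp
      then show ?thesis unfolding add scaleR by simp
    qed
    have "(\<lambda>i \<beta>. p (1, 0) * (d i \<beta> * F i \<beta>) + p (0, 1) * ((e i \<beta>)\<^sup>2 * F i \<beta>)) \<in> L"
      by (intro L_add L_scale L_d L_e2 F)
    then show ?case by (rule L_cong) (subst p, simp add: algebra_simps)
  next
    case (const c)
    then show ?case by (rule L_scale)
  next
    case (add p1 p2)
    show ?case using L_add[OF add.IH(1)[OF add.prems] add.IH(2)[OF add.prems]]
      by (rule L_cong) (simp add: distrib_right)
  next
    case (mult p1 p2)
    show ?case using mult.IH(1)[OF mult.IH(2)[OF mult.prems]]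
      by (rule L_cong) simp
  qed
  have L_zero: "(\<lambda>i \<beta>. 0) \<in> L"
    using fun_span_zero[of n K] by (simp add: L_def control_span_def zero_vec_def)
  have L_cont: "continuous_on K (F i)" if "F \<in> L" "i \<in> {..<n}" for F i
    using control_span_cont[of "\<lambda>\<beta>. vec n (\<lambda>i. F i \<beta>)"] that by (auto simp: L_def cont_vec_fun_def)
  have L_fibre: "\<exists>F\<in>L. \<forall>i\<in>{..<n}. \<forall>\<beta>\<in>K. (d i \<beta>, (e i \<beta>)\<^sup>2) = y \<longrightarrow> F i \<beta> = g i \<beta>" for y
  proof -
    obtain f where f: "f \<in> \<L>" "\<forall>i<n. \<forall>\<beta>\<in>K. (d i \<beta>, (e i \<beta>)\<^sup>2) = y \<longrightarrow> f \<beta> $ i = g i \<beta>"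
      using fibre[of y g] by blast
    then show ?thesis using L_of[OF f(1)] by (intro bexI[of _ "\<lambda>i \<beta>. f \<beta> $ i"]) auto
  qed
  have \<rho>: "continuous_on K (\<lambda>\<beta>. (d i \<beta>, (e i \<beta>)\<^sup>2))" if "i \<in> {..<n}" for i
    using that by (intro continuous_intros continuous_d continuous_e) auto
  have g': "continuous_on K (g i)" if "i \<in> {..<n}" for i using g that by simp
  have "\<exists>F\<in>L. \<forall>i\<in>{..<n}. \<forall>\<beta>\<in>K. \<bar>F i \<beta> - g i \<beta>\<bar> < \<epsilon>"
    by (rule Stone_Weierstrass_module[where \<rho> = "\<lambda>i \<beta>. (d i \<beta>, (e i \<beta>)\<^sup>2)"])
       (fact compact_K finite_lessThan \<rho> L_cont L_zero L_add L_poly g' L_fibre \<open>\<epsilon> > 0\<close>)+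
  then obtain F where F: "F \<in> L" "\<forall>i\<in>{..<n}. \<forall>\<beta>\<in>K. \<bar>F i \<beta> - g i \<beta>\<bar> < \<epsilon>" by blast
  show ?thesis
    using F by (intro bexI[of _ "\<lambda>\<beta>. vec n (\<lambda>i. F i \<beta>)"]) (simp_all add: L_def)
qed

lemma controllable_if_dense:
  assumes dense: "\<And>g \<epsilon>. (\<And>i. i < n \<Longrightarrow> continuous_on K (g i)) \<Longrightarrow> \<epsilon> > 0 \<Longrightarrow>
      \<exists>f\<in>\<L>. \<forall>i<n. \<forall>\<beta>\<in>K. \<bar>f \<beta> $ i - g i \<beta>\<bar> < \<epsilon>"
    and N: "vec_norm_on n N"
  shows "uniformly_ensemble_controllable N K n m A b"
  unfolding uniformly_ensemble_controllable_def
proof (intro allI impI ballI)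
  fix \<epsilon> :: real and X0 XF
  assume "\<epsilon> > 0" and X0: "X0 \<in> cont_vec_fun K n" and XF: "XF \<in> cont_vec_fun K n"
  obtain C where C: "C > 0" "\<And>v. v \<in> carrier_vec n \<Longrightarrow> N v \<le> C * (\<Sum>i<n. \<bar>v $ i\<bar>)"
    using vec_norm_le_sum[OF N] by blast
  \<comment> \<open>\<open>real n + 1\<close> keeps the divisor in \<delta> positive for
    \<open>n = 0\<close> as well.\<close>
  define D where "D = C * (real n + 1)"
  have D: "D > 0" using C(1) by (simp add: D_def)
  define \<delta> where "\<delta> = \<epsilon> / (2 * D)"
  have \<delta>: "\<delta> > 0" using \<open>\<epsilon> > 0\<close> D by (simp add: \<delta>_def)
  \<comment> \<open>What the inputs must contribute by time 1: the target minus the free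
    evolution.\<close>
  define g where "g i \<beta> = XF \<beta> $ i - Re (exp (rate i \<beta>) * paired (X0 \<beta>) i)" for i \<beta>
  have g: "continuous_on K (g i)" if "i < n" for i
    unfolding g_def using XF that
    by (intro continuous_intros continuous_rate continuous_paired X0) (auto simp: cont_vec_fun_def)
  have "step_approximable K {..<n} m rate input_pair g"
  proof (rule step_approximable_closed)
    fix \<eta> :: real assume "\<eta> > 0"
    obtain f where f: "f \<in> \<L>" "\<forall>i<n. \<forall>\<beta>\<in>K. \<bar>f \<beta> $ i - g i \<beta>\<bar> < \<eta>"
      using dense[of g, OF g \<open>\<eta> > 0\<close>] by blast
    then show "\<exists>G. step_approximable K {..<n} m rate input_pair G \<and> (\<forall>i\<in>{..<n}. \<forall>\<beta>\<in>K. \<bar>g i \<beta> - G i \<beta>\<bar> < \<eta>)"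
      using control_span_step_approximable[OF f(1)]
      by (intro exI[of _ "\<lambda>i \<beta>. f \<beta> $ i"]) (auto simp: abs_minus_commute)
  qed
  then obtain xs where xs: "set xs \<subseteq> UNIV \<times> {0..1} \<times> {..<m}"
      "\<forall>i\<in>{..<n}. \<forall>\<beta>\<in>K. \<bar>g i \<beta> - step_resp rate input_pair xs i \<beta>\<bar> < \<delta>"
    using \<delta> unfolding step_approximable_def by blast
  show "\<exists>T>0. \<exists>u X. piecewise_const_control m T u \<and> ensemble_solution K n m A b T u X \<and>
      (\<forall>\<beta>\<in>K. X 0 \<beta> = X0 \<beta>) \<and> (SUP \<beta>\<in>K. ennreal (N (X T \<beta> - XF \<beta>))) < ennreal \<epsilon>"
  proof (rule exists_step_control[OF xs(1) X0])
    fix u X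
    assume uX: "piecewise_const_control m 1 u" "ensemble_solution K n m A b 1 u X"
        "\<And>\<beta>. \<beta> \<in> K \<Longrightarrow> X 0 \<beta> = X0 \<beta>"
        "\<And>\<beta>. X 1 \<beta> = vec n (\<lambda>i. Re (exp (rate i \<beta>) * paired (X0 \<beta>) i) + step_resp rate input_pair xs i \<beta>)"
    have "N (X 1 \<beta> - XF \<beta>) \<le> \<epsilon> / 2" if \<beta>: "\<beta> \<in> K" for \<beta>
    proof -
      have XF\<beta>: "XF \<beta> \<in> carrier_vec n" using XF \<beta> by (auto simp: cont_vec_fun_def)
      then have "X 1 \<beta> - XF \<beta> \<in> carrier_vec n" by (simp add: uX(4))
      then have "N (X 1 \<beta> - XF \<beta>) \<le> C * (\<Sum>i<n. \<bar>(X 1 \<beta> - XF \<beta>) $ i\<bar>)" by (rule C(2))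
      also have "(\<Sum>i<n. \<bar>(X 1 \<beta> - XF \<beta>) $ i\<bar>) \<le> (\<Sum>i<n. \<delta>)"
      proof (rule sum_mono)
        fix i assume "i \<in> {..<n}"
        then have "(X 1 \<beta> - XF \<beta>) $ i = - (g i \<beta> - step_resp rate input_pair xs i \<beta>)"
          using carrier_vecD[OF XF\<beta>] by (simp add: uX(4) g_def)
        moreover have "\<bar>g i \<beta> - step_resp rate input_pair xs i \<beta>\<bar> < \<delta>"
          using xs(2) \<beta> \<open>i \<in> {..<n}\<close> by blast
        ultimately show "\<bar>(X 1 \<beta> - XF \<beta>) $ i\<bar> \<le> \<delta>" by (simp only: abs_minus_cancel)
      qed
      also have "C * (\<Sum>i<n. \<delta>) \<le> C * ((real n + 1) * \<delta>)"
        using C(1) \<delta> by (intro mult_left_mono) (simp_all add: distrib_right)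
      also have "\<dots> = D * \<delta>" by (simp add: D_def)
      also have "\<dots> = \<epsilon> / 2" using D by (simp add: \<delta>_def)
      finally show ?thesis using C(1) by simp
    qed
    \<comment> \<open>The bound \<epsilon>/2 leaves room, since a supremum of values below
      \<epsilon> could equal \<epsilon>.\<close>
    then have "(SUP \<beta>\<in>K. ennreal (N (X 1 \<beta> - XF \<beta>))) \<le> ennreal (\<epsilon> / 2)"
      by (intro SUP_least ennreal_leI)
    also have "\<dots> < ennreal \<epsilon>" using \<open>\<epsilon> > 0\<close> by (intro ennreal_lessI) auto
    finally show ?thesis
      using uX(1,2,3) by (intro exI[of _ 1] conjI exI[of _ u] exI[of _ X]) auto
  qed
qed

section \<open>Interpolation within the control span\<close>

lemma control_span_sum:
  assumes "finite S" "\<And>s. s \<in> S \<Longrightarrow> h s \<in> \<L>"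
  shows "(\<lambda>\<beta>. vec n (\<lambda>i. \<Sum>s\<in>S. x s * h s \<beta> $ i)) \<in> \<L>"
  using assms
proof (induction S rule: finite_induct)
  case empty
  show ?case using fun_span_zero[of n K] by (simp add: control_span_def zero_vec_def)
next
  case (insert s S)
  \<comment> \<open>\<open>fun_span\<close> attaches coefficients to functions, not to indices;
    adding one index at a time merges generators that coincide.\<close>
  have "(\<lambda>\<beta>. x s \<cdot>\<^sub>v h s \<beta> + vec n (\<lambda>i. \<Sum>s\<in>S. x s * h s \<beta> $ i)) \<in> \<L>"
    using insert unfolding control_span_def by (intro fun_span_add fun_span_smult) simp_all
  then show ?case
    unfolding control_span_def
  proof (rule fun_span_cong)
    fix \<beta> assume "\<beta> \<in> K"
    then have "dim_vec (h s \<beta>) = n" using control_span_carrier[of "h s" \<beta>] insert by simp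
    then show "vec n (\<lambda>i. \<Sum>s\<in>insert s S. x s * h s \<beta> $ i) = x s \<cdot>\<^sub>v h s \<beta> + vec n (\<lambda>i. \<Sum>s\<in>S. x s * h s \<beta> $ i)"
      using insert by (intro eq_vecI) simp_all
  qed
qed

abbreviation ctrb :: "real list \<Rightarrow> real mat" where
  "ctrb ps \<equiv> ensemble_controllability_matrix n m A (input_mat n m b) ps"

lemma ctrb_index:
  assumes "i < n * length ps" "c < m * n * length ps" "set ps \<subseteq> K"
  shows "ctrb ps $$ (i, c) = (A (ps ! (i div n)) ^\<^sub>m (c div m) *\<^sub>v b (c mod m) (ps ! (i div n))) $ (i mod n)"
proof -
  have n: "n > 0" and m: "m > 0" using assms(1,2) by (auto intro!: gr0I)
  define \<beta> where "\<beta> = ps ! (i div n)"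
  have "i div n < length ps" using assms(1) by (simp add: less_mult_imp_div_less mult.commute)
  then have \<beta>: "\<beta> \<in> K" using assms(3) nth_mem by (auto simp: \<beta>_def)
  have carr: "A \<beta> ^\<^sub>m (c div m) \<in> carrier_mat n n" by (rule pow_A_carrier)
  have "col (input_mat n m b \<beta>) (c mod m) = b (c mod m) \<beta>"
    using m \<beta> b_carrier[of "c mod m" \<beta>] by (simp add: input_mat_def)
  then show ?thesis
    using assms(1,2) n m carrier_matD[OF carr]
    by (simp add: ensemble_controllability_matrix_def \<beta>_def[symmetric]) (simp add: input_mat_def)
qed

text \<open>A coefficient vector for the columns is at the same time a coefficient vector for an
  element of the control span, and the matrix product lists the values of that element at the
  points.\<close>

lemma interpolation_if_ctrb_surj:
  assumes ps: "set ps \<subseteq> K" and n: "n > 0"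
    and surj: "\<forall>v\<in>carrier_vec (n * length ps). \<exists>x\<in>carrier_vec (m * n * length ps). ctrb ps *\<^sub>v x = v"
  shows "\<exists>f\<in>\<L>. \<forall>p<length ps. \<forall>i<n. f (ps ! p) $ i = h i (ps ! p)"
proof -
  define v where "v = vec (n * length ps) (\<lambda>k. h (k mod n) (ps ! (k div n)) :: real)"
  have "v \<in> carrier_vec (n * length ps)" by (simp add: v_def)
  with surj obtain x where x: "x \<in> carrier_vec (m * n * length ps)" "ctrb ps *\<^sub>v x = v" by blast
  define c where "c = m * n * length ps"
  define f where "f \<beta> = vec n (\<lambda>i. \<Sum>s<c. x $ s * (A \<beta> ^\<^sub>m (s div m) *\<^sub>v b (s mod m) \<beta>) $ i)" for \<beta>
  have "f \<in> \<L>"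
    unfolding f_def
  proof (rule control_span_sum)
    fix s assume "s \<in> {..<c}"
    then have "m > 0" by (auto simp: c_def intro!: gr0I)
    then show "(\<lambda>\<beta>. A \<beta> ^\<^sub>m (s div m) *\<^sub>v b (s mod m) \<beta>) \<in> \<L>"
      by (intro control_span_base) simp
  qed simp
  moreover have "f (ps ! p) $ i = h i (ps ! p)" if p: "p < length ps" and i: "i < n" for p i
  proof -
    define k where "k = p * n + i"
    have k_div: "k div n = p" and k_mod: "k mod n = i" using i by (simp_all add: k_def)
    have "k < Suc p * n" using i by (simp add: k_def)
    also have "\<dots> \<le> length ps * n" using p by (intro mult_right_mono) auto
    finally have k: "k < n * length ps" by (simp add: mult.commute)
    have dims: "dim_row (ctrb ps) = n * length ps" "dim_col (ctrb ps) = c"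
      by (simp_all add: ensemble_controllability_matrix_def c_def)
    have "h i (ps ! p) = (ctrb ps *\<^sub>v x) $ k"
      unfolding x(2) v_def using k k_div k_mod by simp
    also have "\<dots> = (\<Sum>s<c. ctrb ps $$ (k, s) * x $ s)"
      using k dims x(1) by (simp add: scalar_prod_def atLeast0LessThan c_def)
    also have "\<dots> = f (ps ! p) $ i"
      unfolding f_def using i k ps
      by (simp add: ctrb_index c_def k_div k_mod mult.commute del: index_mult_mat_vec)
    finally show ?thesis by simp
  qed
  ultimately show ?thesis by blast
qed

end

section \<open>Necessity of the rank condition\<close>

text \<open>Replaces the Cayley-Hamilton theorem: the monic polynomial with roots \<open>z q\<close> yields a recurrence
  of order \<open>card Q\<close> for the moments, with real coefficients since the roots are closed under
  conjugation.\<close>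
lemma moments_vanish_of_initial:
  fixes w :: "'q \<Rightarrow> real" and z P :: "'q \<Rightarrow> complex"
  assumes Q: "finite Q" and conj_root: "\<And>q. q \<in> Q \<Longrightarrow> \<exists>q'\<in>Q. z q' = cnj (z q)"
    and init: "\<And>k. k < card Q \<Longrightarrow> (\<Sum>q\<in>Q. w q * Re (z q ^ k * P q)) = 0"
  shows "(\<Sum>q\<in>Q. w q * Re (z q ^ k * P q)) = 0"
proof (induction k rule: less_induct)
  case (less k)
  define N where "N = card Q"
  show ?case
  proof (cases "k < N")
    case True
    then show ?thesis using init by (simp add: N_def)
  next
    case False
    define R where "R = (\<Prod>q\<in>Q. [:- z q, 1:])"
    have "degree R = (\<Sum>q\<in>Q. degree [:- z q, 1:])"
      unfolding R_def by (rule degree_prod_eq_sum_degree) simp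
    then have deg: "degree R = N" by (simp add: N_def)
    have "lead_coeff R = (\<Prod>q\<in>Q. lead_coeff [:- z q, 1:])"
      unfolding R_def by (rule lead_coeff_prod)
    then have lead: "coeff R N = 1" by (simp add: deg)
    have root: "poly R (z q) = 0" if "q \<in> Q" for q
      unfolding R_def poly_prod using Q that by (intro prod_zero bexI[of _ q]) simp_all
    \<comment> \<open>A root and its conjugate may occur with different multiplicities, so
      \<open>R\<close> itself may fail to be real. The mean of \<open>R\<close> and its conjugate is
      real, still monic of degree \<open>N\<close>, and vanishes at every
      \<open>z q\<close>.\<close>
    define r where "r l = Re (coeff R l)" for l
    have real_root: "(\<Sum>l\<le>N. of_real (r l) * z q ^ l) = 0" if q: "q \<in> Q" for q
    proof -
      obtain q' where "q' \<in> Q" "z q' = cnj (z q)" using conj_root[OF q] by blast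
      then have "poly R (cnj (z q)) = 0" using root[of q'] by simp
      then have "cnj (\<Sum>l\<le>N. coeff R l * cnj (z q) ^ l) = 0" by (simp add: poly_altdef deg)
      then have "(\<Sum>l\<le>N. cnj (coeff R l) * z q ^ l) = 0" by simp
      moreover have "(\<Sum>l\<le>N. coeff R l * z q ^ l) = 0"
        using root[OF q] by (simp add: poly_altdef deg)
      ultimately have "(\<Sum>l\<le>N. (coeff R l + cnj (coeff R l)) * z q ^ l) = 0"
        by (simp add: distrib_right sum.distrib)
      then have "2 * (\<Sum>l\<le>N. of_real (r l) * z q ^ l) = 0"
        by (simp add: r_def complex_add_cnj sum_distrib_left mult.assoc)
      then show ?thesis by simp
    qed
    have pow: "z q ^ k = - (\<Sum>l<N. of_real (r l) * z q ^ (l + (k - N)))" if "q \<in> Q" for q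
    proof -
      have "(\<Sum>l<N. of_real (r l) * z q ^ l) + z q ^ N = 0"
        using real_root[OF that] by (simp add: lessThan_Suc_atMost[symmetric] r_def lead)
      then have "((\<Sum>l<N. of_real (r l) * z q ^ l) + z q ^ N) * z q ^ (k - N) = 0" by simp
      then show ?thesis
        using False by (simp add: distrib_right sum_distrib_right power_add[symmetric] mult.assoc
            eq_neg_iff_add_eq_0 add.commute)
    qed
    have "(\<Sum>q\<in>Q. w q * Re (z q ^ k * P q))
        = (\<Sum>q\<in>Q. \<Sum>l<N. - (r l * (w q * Re (z q ^ (l + (k - N)) * P q))))"
    proof (rule sum.cong[OF refl])
      fix q assume "q \<in> Q"
      have "z q ^ k * P q = (\<Sum>l<N. of_real (- r l) * (z q ^ (l + (k - N)) * P q))"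
        unfolding pow[OF \<open>q \<in> Q\<close>] by (simp add: sum_distrib_right sum_negf mult.assoc)
      then have "Re (z q ^ k * P q) = (\<Sum>l<N. - r l * Re (z q ^ (l + (k - N)) * P q))"
        by (simp only: Re_sum times_complex.sel Re_complex_of_real Im_complex_of_real) simp
      then show "w q * Re (z q ^ k * P q) = (\<Sum>l<N. - (r l * (w q * Re (z q ^ (l + (k - N)) * P q))))"
        by (simp only: sum_distrib_left) (simp add: algebra_simps)
    qed
    also have "\<dots> = (\<Sum>l<N. \<Sum>q\<in>Q. - (r l * (w q * Re (z q ^ (l + (k - N)) * P q))))"
      by (rule sum.swap)
    also have "\<dots> = (\<Sum>l<N. - (r l * (\<Sum>q\<in>Q. w q * Re (z q ^ (l + (k - N)) * P q))))"
      by (simp only: sum_negf sum_distrib_left)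
    also have "\<dots> = (\<Sum>l<N. 0)"
      using False less.IH by (intro sum.cong refl) simp
    finally show ?thesis by simp
  qed
qed

text \<open>Every term of the exponential series contributes a multiple of a vanishing
  moment.\<close>

lemma exp_moment_vanishes:
  fixes w :: "'q \<Rightarrow> real" and z P :: "'q \<Rightarrow> complex"
  assumes "\<And>k. (\<Sum>q\<in>Q. w q * Re (z q ^ k * P q)) = 0"
  shows "(\<Sum>q\<in>Q. w q * Re (exp (of_real \<tau> * z q) * P q)) = 0"
proof -
  have "(\<lambda>k. \<Sum>q\<in>Q. w q * Re (((of_real \<tau> * z q) ^ k /\<^sub>R fact k) * P q)) sums
      (\<Sum>q\<in>Q. w q * Re (exp (of_real \<tau> * z q) * P q))"
    by (intro sums_sum sums_mult sums_Re sums_mult2 exp_converges)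
  moreover have "(\<Sum>q\<in>Q. w q * Re (((of_real \<tau> * z q) ^ k /\<^sub>R fact k) * P q)) = 0" for k
  proof -
    have "((of_real \<tau> * z q) ^ k /\<^sub>R fact k) * P q = of_real (\<tau> ^ k / fact k) * (z q ^ k * P q)" for q
      by (simp add: scaleR_conv_of_real power_mult_distrib field_simps)
    then have "w q * Re (((of_real \<tau> * z q) ^ k /\<^sub>R fact k) * P q)
        = \<tau> ^ k / fact k * (w q * Re (z q ^ k * P q))" for q
      by (simp only: times_complex.sel Re_complex_of_real Im_complex_of_real) simp
    then show ?thesis using assms[of k] by (simp only: sum_distrib_left[symmetric] mult_zero_right)
  qed
  ultimately show ?thesis using sums_unique2 sums_zero by (metis (no_types, lifting) sums_cong)
qed

text \<open>Lagrange interpolation; it supplies a continuous target with prescribed values at the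
  points of a fibre.\<close>

lemma continuous_interpolation:
  fixes ps :: "real list"
  assumes "distinct ps"
  obtains h :: "real \<Rightarrow> real" where "continuous_on UNIV h" "\<And>p. p < length ps \<Longrightarrow> h (ps ! p) = y p"
proof -
  define lag where "lag p x = (\<Prod>p'\<in>{..<length ps} - {p}. (x - ps ! p') / (ps ! p - ps ! p'))" for p x
  define h where "h x = (\<Sum>p<length ps. y p * lag p x)" for x
  have "lag p (ps ! p) = 1" if "p < length ps" for p
    unfolding lag_def using assms that by (intro prod.neutral) (auto simp: nth_eq_iff_index_eq)
  moreover have "lag p (ps ! p') = 0" if "p' < length ps" "p \<noteq> p'" for p p'
    unfolding lag_def using that by (intro prod_zero) auto
  ultimately have "h (ps ! p) = (\<Sum>p'<length ps. if p' = p then y p else 0)" if "p < length ps" for p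
    unfolding h_def using that by (intro sum.cong) auto
  then have "h (ps ! p) = y p" if "p < length ps" for p using that by simp
  moreover have "continuous_on UNIV h"
    unfolding h_def lag_def divide_inverse by (intro continuous_intros)
  ultimately show ?thesis by (rule that[rotated])
qed

context block_ensemble
begin

text \<open>\<open>\<Phi> t\<close> below applies the functional to the free evolution of the state at time \<open>t\<close> up to time
  \<open>T\<close>. The inputs do not contribute to its derivative, so it is constant.\<close>
lemma vanishing_functional_of_solution:
  fixes w :: "'q \<Rightarrow> real" and pt :: "'q \<Rightarrow> real" and ix :: "'q \<Rightarrow> nat"
  assumes Q: "finite Q" and pt: "\<And>q. q \<in> Q \<Longrightarrow> pt q \<in> K" and ix: "\<And>q. q \<in> Q \<Longrightarrow> ix q < n"
    and van: "\<And>k j. j < m \<Longrightarrow> (\<Sum>q\<in>Q. w q * (A (pt q) ^\<^sub>m k *\<^sub>v b j (pt q)) $ ix q) = 0"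
    and sol: "ensemble_solution K n m A b T u X" and "T > 0"
    and X0: "\<And>\<beta>. \<beta> \<in> K \<Longrightarrow> X 0 \<beta> = 0\<^sub>v n"
  shows "(\<Sum>q\<in>Q. w q * X T (pt q) $ ix q) = 0"
proof -
  define z where "z q = rate (ix q) (pt q)" for q
  have moments: "(\<Sum>q\<in>Q. w q * Re (z q ^ k * input_pair j (ix q) (pt q))) = 0" if "j < m" for k j
    using van[OF that, of k] pt ix that by (simp add: pow_A_index b_carrier z_def)
  have exp_moments: "(\<Sum>q\<in>Q. w q * Re (exp (of_real \<tau> * z q) * input_pair j (ix q) (pt q))) = 0"
    if "j < m" for j \<tau>
    by (rule exp_moment_vanishes) (rule moments[OF that])
  obtain D where D: "finite D" and X_deriv: "\<And>t \<beta> i. t \<in> {0..T} - D \<Longrightarrow> \<beta> \<in> K \<Longrightarrow> i < n \<Longrightarrow>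
        ((\<lambda>s. X s \<beta> $ i) has_real_derivative
           (A \<beta> *\<^sub>v X t \<beta>) $ i + (\<Sum>j<m. b j \<beta> $ i * u t $ j)) (at t within {0..T})"
    using sol unfolding ensemble_solution_def by auto
  have X_time: "continuous_on {0..T} (\<lambda>t. X t \<beta> $ i)" if "\<beta> \<in> K" "i < n" for \<beta> i
    using sol that unfolding ensemble_solution_def by blast
  have X_carrier: "X t \<beta> \<in> carrier_vec n" if "t \<in> {0..T}" "\<beta> \<in> K" for t \<beta>
    using sol that unfolding ensemble_solution_def cont_vec_fun_def by blast
  have paired_time: "continuous_on {0..T} (\<lambda>t. paired (X t \<beta>) i)" if "\<beta> \<in> K" "i < n" for \<beta> i
    unfolding paired_def using that by (intro continuous_intros X_time \<sigma>_less)
  have paired_deriv: "((\<lambda>s. paired (X s \<beta>) i) has_vector_derivative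
      rate i \<beta> * paired (X t \<beta>) i + (\<Sum>j<m. of_real (u t $ j) * input_pair j i \<beta>)) (at t within {0..T})"
    if t: "t \<in> {0..T} - D" and \<beta>: "\<beta> \<in> K" and i: "i < n" for t \<beta> i
  proof -
    have "X t \<beta> \<in> carrier_vec n" using X_carrier t \<beta> by blast
    from paired_mult_A[OF this i, symmetric] have "rate i \<beta> * paired (X t \<beta>) i = paired (A \<beta> *\<^sub>v X t \<beta>) i" .
    then show ?thesis
      unfolding has_vector_derivative_complex_iff
      using X_deriv[OF t \<beta> i] X_deriv[OF t \<beta> \<sigma>_less[OF i]]
      by (simp add: paired_def mult.commute)
  qed
  define \<Phi> where "\<Phi> t = (\<Sum>q\<in>Q. w q * Re (exp (of_real (T - t) * z q) * paired (X t (pt q)) (ix q)))" for t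
  have \<Phi>_cont: "continuous_on {0..T} \<Phi>"
    unfolding \<Phi>_def by (intro continuous_intros paired_time pt ix)
  have \<Phi>_deriv: "(\<Phi> has_derivative (\<lambda>h. 0)) (at t within {0..T})" if t: "t \<in> {0..T} - D" for t
  proof -
    have dexp: "((\<lambda>t. exp (of_real (T - t) * z)) has_vector_derivative - (z * exp (of_real (T - t) * z))) (at t within {0..T})" for z :: complex
    proof -
      have "((\<lambda>t. T - t) has_vector_derivative - 1) (at t)"
        by (auto intro!: derivative_eq_intros)
      from vector_diff_chain_at[OF this exp_scaleR_has_vector_derivative_right[of z "T - t" UNIV]]
      show ?thesis
        by (auto simp: o_def scaleR_conv_of_real mult.commute intro: has_vector_derivative_at_within)
    qed
    have deriv: "((\<lambda>t. w q * Re (exp (of_real (T - t) * z q) * paired (X t (pt q)) (ix q))) has_vector_derivative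
        w q * Re (exp (of_real (T - t) * z q) * (\<Sum>j<m. of_real (u t $ j) * input_pair j (ix q) (pt q)))) (at t within {0..T})"
      if q: "q \<in> Q" for q
    proof -
      have "((\<lambda>t. exp (of_real (T - t) * z q) * paired (X t (pt q)) (ix q)) has_vector_derivative
          exp (of_real (T - t) * z q) * (z q * paired (X t (pt q)) (ix q)
              + (\<Sum>j<m. of_real (u t $ j) * input_pair j (ix q) (pt q)))
          + - (z q * exp (of_real (T - t) * z q)) * paired (X t (pt q)) (ix q)) (at t within {0..T})"
        unfolding z_def by (intro has_vector_derivative_mult dexp paired_deriv[OF t] pt ix q)
      moreover have "exp (of_real (T - t) * z q) * (z q * paired (X t (pt q)) (ix q)
              + (\<Sum>j<m. of_real (u t $ j) * input_pair j (ix q) (pt q)))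
          + - (z q * exp (of_real (T - t) * z q)) * paired (X t (pt q)) (ix q)
          = exp (of_real (T - t) * z q) * (\<Sum>j<m. of_real (u t $ j) * input_pair j (ix q) (pt q))"
        by (simp add: algebra_simps)
      ultimately have "((\<lambda>t. exp (of_real (T - t) * z q) * paired (X t (pt q)) (ix q)) has_vector_derivative
          exp (of_real (T - t) * z q) * (\<Sum>j<m. of_real (u t $ j) * input_pair j (ix q) (pt q))) (at t within {0..T})"
        by (simp only:)
      from has_vector_derivative_mult_right[OF bounded_linear.has_vector_derivative[OF bounded_linear_Re this]]
      show ?thesis .
    qed
    have "(\<Phi> has_vector_derivative (\<Sum>q\<in>Q. w q * Re (exp (of_real (T - t) * z q)
        * (\<Sum>j<m. of_real (u t $ j) * input_pair j (ix q) (pt q))))) (at t within {0..T})"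
      unfolding \<Phi>_def by (intro has_vector_derivative_sum deriv)
    \<comment> \<open>At fixed \<open>t\<close> the values \<open>u t $ j\<close> come out of the
      sum over \<open>q\<close>; what remains are the exponential moments for the time
      \<open>T - t\<close>, one per channel.\<close>
    moreover have "(\<Sum>q\<in>Q. w q * Re (exp (of_real (T - t) * z q)
        * (\<Sum>j<m. of_real (u t $ j) * input_pair j (ix q) (pt q)))) = 0"
    proof -
      have "w q * Re (exp (of_real (T - t) * z q) * (\<Sum>j<m. of_real (u t $ j) * input_pair j (ix q) (pt q)))
          = (\<Sum>j<m. u t $ j * (w q * Re (exp (of_real (T - t) * z q) * input_pair j (ix q) (pt q))))" for q
      proof -
        have "exp (of_real (T - t) * z q) * (\<Sum>j<m. of_real (u t $ j) * input_pair j (ix q) (pt q))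
            = (\<Sum>j<m. of_real (u t $ j) * (exp (of_real (T - t) * z q) * input_pair j (ix q) (pt q)))"
          unfolding sum_distrib_left by (intro sum.cong refl) (simp only: mult.left_commute)
        moreover have "Re (of_real a * c) = a * Re c" for a c by simp
        ultimately show ?thesis
          by (simp only: Re_sum) (simp only: sum_distrib_left mult.left_commute)
      qed
      then have "(\<Sum>q\<in>Q. w q * Re (exp (of_real (T - t) * z q)
            * (\<Sum>j<m. of_real (u t $ j) * input_pair j (ix q) (pt q))))
          = (\<Sum>q\<in>Q. \<Sum>j<m. u t $ j * (w q * Re (exp (of_real (T - t) * z q) * input_pair j (ix q) (pt q))))"
        by (simp only:)
      also have "\<dots> = (\<Sum>j<m. u t $ j * (\<Sum>q\<in>Q. w q * Re (exp (of_real (T - t) * z q) * input_pair j (ix q) (pt q))))"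
        unfolding sum_distrib_left by (rule sum.swap)
      also have "\<dots> = (\<Sum>j<m. 0)"
        by (intro sum.cong refl) (simp only: exp_moments lessThan_iff mult_zero_right)
      finally show ?thesis by simp
    qed
    ultimately have "(\<Phi> has_vector_derivative 0) (at t within {0..T})" by (simp only:)
    then show ?thesis by (simp add: has_vector_derivative_def)
  qed
  \<comment> \<open>The derivative is known only off the finite set \<open>D\<close>; continuity
    carries the constancy across it.\<close>
  have "\<Phi> T = \<Phi> 0"
    by (rule has_derivative_zero_unique_strong_interval[OF D \<Phi>_cont refl \<Phi>_deriv]) (use \<open>T > 0\<close> in auto)
  moreover have "\<Phi> 0 = 0"
    unfolding \<Phi>_def using X0 pt ix by (intro sum.neutral) (simp add: paired_def \<sigma>_less)
  moreover have "\<Phi> T = (\<Sum>q\<in>Q. w q * X T (pt q) $ ix q)"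
    unfolding \<Phi>_def by (simp add: paired_def)
  ultimately show ?thesis by simp
qed

lemma ctrb_surj_if_controllable:
  assumes ctl: "uniformly_ensemble_controllable N K n m A b" and N: "vec_norm_on n N"
    and ps: "distinct ps" "set ps \<subseteq> K" and n: "n > 0"
  shows "\<forall>v\<in>carrier_vec (n * length ps). \<exists>x\<in>carrier_vec (m * n * length ps). ctrb ps *\<^sub>v x = v"
proof (rule ccontr)
  define M where "M = n * length ps"
  have carr: "ctrb ps \<in> carrier_mat (n * length ps) (m * n * length ps)"
    by (simp add: ensemble_controllability_matrix_def)
  assume "\<not> ?thesis"
  then obtain w where w: "w \<in> carrier_vec M" "w \<noteq> 0\<^sub>v M" "(ctrb ps)\<^sup>T *\<^sub>v w = 0\<^sub>v (m * n * length ps)"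
    using not_surj_imp_left_kernel[OF carr] unfolding M_def by metis
  define pt where "pt q = ps ! (q div n)" for q
  define ix where "ix q = q mod n" for q
  have div_less: "q div n < length ps" if "q < M" for q
    using that by (simp add: M_def less_mult_imp_div_less mult.commute)
  have pt: "pt q \<in> K" if "q \<in> {..<M}" for q
    using div_less that ps(2) by (auto simp: pt_def)
  have ix: "ix q < n" if "q \<in> {..<M}" for q using n by (simp add: ix_def)
  \<comment> \<open>Here the width of the matrix matters: it contains all powers below
    \<open>M\<close>, and \<open>M\<close>, the number of pairs of a point and a coordinate, is the
    order of the recurrence.\<close>
  have init: "(\<Sum>q<M. w $ q * Re (rate (ix q) (pt q) ^ k * input_pair j (ix q) (pt q))) = 0"
    if k: "k < card {..<M}" and j: "j < m" for k j
  proof -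
    define c where "c = k * m + j"
    have c_div: "c div m = k" and c_mod: "c mod m = j" using j by (simp_all add: c_def)
    have "c < Suc k * m" using j by (simp add: c_def)
    also have "\<dots> \<le> M * m" using k by (intro mult_right_mono) auto
    finally have c: "c < m * n * length ps" by (simp add: M_def mult.commute mult.left_commute)
    have "0 = ((ctrb ps)\<^sup>T *\<^sub>v w) $ c" unfolding w(3) using c by simp
    also have "\<dots> = (\<Sum>q<M. w $ q * ctrb ps $$ (q, c))"
      using carrier_matD[OF carr] c carrier_vecD[OF w(1)]
      by (simp add: scalar_prod_def atLeast0LessThan M_def mult.commute)
    also have "\<dots> = (\<Sum>q<M. w $ q * Re (rate (ix q) (pt q) ^ k * input_pair j (ix q) (pt q)))"
    proof (intro sum.cong refl arg_cong2[of _ _ _ _ "(*)"])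
      fix q assume q: "q \<in> {..<M}"
      then have "ctrb ps $$ (q, c) = (A (pt q) ^\<^sub>m k *\<^sub>v b j (pt q)) $ ix q"
        using ctrb_index[OF _ c ps(2), of q] by (simp add: c_div c_mod pt_def ix_def M_def del: index_mult_mat_vec)
      then show "ctrb ps $$ (q, c) = Re (rate (ix q) (pt q) ^ k * input_pair j (ix q) (pt q))"
        using pow_A_index[OF b_carrier[OF j pt[OF q]] ix[OF q]] by (simp only:)
    qed
    finally show ?thesis by simp
  qed
  \<comment> \<open>The conjugate rate belongs to the partner coordinate at the same point.\<close>
  have conj: "\<exists>q'\<in>{..<M}. rate (ix q') (pt q') = cnj (rate (ix q) (pt q))" if q: "q \<in> {..<M}" for q
  proof (rule bexI)
    let ?q = "(q div n) * n + \<sigma> (ix q)"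
    have "\<sigma> (ix q) < n" using ix[OF q] by (rule \<sigma>_less)
    then have eq: "?q div n = q div n" "?q mod n = \<sigma> (ix q)" by simp_all
    then show "rate (ix ?q) (pt ?q) = cnj (rate (ix q) (pt q))"
      by (simp add: ix_def pt_def rate_\<sigma>)
    have "?q < Suc (q div n) * n" using \<open>\<sigma> (ix q) < n\<close> by simp
    also have "\<dots> \<le> length ps * n" using div_less[of q] q by (intro mult_right_mono) auto
    finally show "?q \<in> {..<M}" by (simp add: M_def mult.commute)
  qed
  have moments: "(\<Sum>q<M. w $ q * Re (rate (ix q) (pt q) ^ k * input_pair j (ix q) (pt q))) = 0"
    if "j < m" for k j
    by (rule moments_vanish_of_initial[OF finite_lessThan conj init[OF _ that]])
  have van: "(\<Sum>q<M. w $ q * (A (pt q) ^\<^sub>m k *\<^sub>v b j (pt q)) $ ix q) = 0" if j: "j < m" for k j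
  proof -
    have "(A (pt q) ^\<^sub>m k *\<^sub>v b j (pt q)) $ ix q = Re (rate (ix q) (pt q) ^ k * input_pair j (ix q) (pt q))"
      if "q \<in> {..<M}" for q
      by (rule pow_A_index[OF b_carrier[OF j pt[OF that]] ix[OF that]])
    then show ?thesis using moments[OF j, of k] by (simp only: cong: sum.cong)
  qed
  have "\<exists>h. continuous_on UNIV h \<and> (\<forall>p<length ps. h (ps ! p) = w $ (p * n + i))" for i
    by (rule continuous_interpolation[OF ps(1), of "\<lambda>p. w $ (p * n + i)"]) blast
  then obtain h where h: "\<And>i. continuous_on UNIV (h i)"
      "\<And>i p. p < length ps \<Longrightarrow> h i (ps ! p) = w $ (p * n + i)"
    by metis
  \<comment> \<open>A continuous target whose coordinates at the points are the entries of
    \<open>w\<close>, so that the functional takes the value \<open>S > 0\<close> on it.\<close>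
  define XF where "XF \<beta> = vec n (\<lambda>i. h i \<beta>)" for \<beta>
  have XF: "XF \<in> cont_vec_fun K n"
    using h(1) by (auto simp: cont_vec_fun_def XF_def intro: continuous_on_subset)
  have XF_pt: "XF (pt q) $ ix q = w $ q" if "q \<in> {..<M}" for q
    using ix[OF that] h(2)[OF div_less, of q] that by (simp add: XF_def pt_def ix_def)
  have zero: "(\<lambda>\<beta>. 0\<^sub>v n) \<in> cont_vec_fun K n" by (simp add: cont_vec_fun_def)
  define S where "S = (\<Sum>q<M. (w $ q)\<^sup>2)"
  obtain q0 where "q0 < M" "w $ q0 \<noteq> 0"
    using w(1,2) by (metis carrier_vecD eq_vecI index_zero_vec(1) index_zero_vec(2))
  then have S: "S > 0" unfolding S_def by (intro sum_pos2[of _ q0]) auto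
  obtain c where c: "c > 0" "\<And>v. v \<in> carrier_vec n \<Longrightarrow> (\<Sum>i<n. \<bar>v $ i\<bar>) \<le> c * N v"
    using sum_le_vec_norm[OF N] by blast
  define W where "W = (\<Sum>q<M. \<bar>w $ q\<bar>)"
  have W: "W \<ge> 0" unfolding W_def by (simp add: sum_nonneg)
  \<comment> \<open>The functional changes by at most \<open>W * (c * \<epsilon>)\<close> between
    the target and the reached state. This equals \<open>S * (W / (W + 1))\<close>, which is less
    than \<open>S\<close>, although the functional is 0 at the reached state.\<close>
  define \<epsilon> where "\<epsilon> = S / (c * (W + 1))"
  have \<epsilon>: "\<epsilon> > 0" using S c(1) W by (simp add: \<epsilon>_def)
  obtain T u X where T: "T > 0" and sol: "ensemble_solution K n m A b T u X"
      and X0: "\<forall>\<beta>\<in>K. X 0 \<beta> = 0\<^sub>v n"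
      and close: "(SUP \<beta>\<in>K. ennreal (N (X T \<beta> - XF \<beta>))) < ennreal \<epsilon>"
    using ctl \<epsilon> zero XF unfolding uniformly_ensemble_controllable_def by meson
  have X_carrier: "X T \<beta> \<in> carrier_vec n" if "\<beta> \<in> K" for \<beta>
    using sol that T unfolding ensemble_solution_def cont_vec_fun_def by auto
  have vanX: "(\<Sum>q<M. w $ q * X T (pt q) $ ix q) = 0"
    by (rule vanishing_functional_of_solution[OF finite_lessThan pt ix van sol T]) (use X0 in auto)
  have comp: "\<bar>w $ q - X T (pt q) $ ix q\<bar> \<le> c * \<epsilon>" if q: "q \<in> {..<M}" for q
  proof -
    let ?v = "X T (pt q) - XF (pt q)"
    have v: "?v \<in> carrier_vec n"
      using X_carrier[OF pt[OF q]] by (intro minus_carrier_vec) (simp_all add: XF_def)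
    have "ennreal (N ?v) < ennreal \<epsilon>"
      using close pt[OF q] by (meson SUP_upper le_less_trans)
    then have "N ?v \<le> \<epsilon>" using \<epsilon> by (meson ennreal_leI not_less linorder_le_cases)
    moreover have "\<bar>?v $ ix q\<bar> \<le> (\<Sum>i<n. \<bar>?v $ i\<bar>)"
      using ix[OF q] by (intro member_le_sum) auto
    moreover have "\<bar>?v $ ix q\<bar> = \<bar>w $ q - X T (pt q) $ ix q\<bar>"
      using ix[OF q] XF_pt[OF q] by (simp add: XF_def abs_minus_commute)
    moreover have "c * N ?v \<le> c * \<epsilon>" using \<open>N ?v \<le> \<epsilon>\<close> c(1) by simp
    ultimately show ?thesis using c(2)[OF v] by linarith
  qed
  have "S = (\<Sum>q<M. w $ q * w $ q) - (\<Sum>q<M. w $ q * X T (pt q) $ ix q)"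
    unfolding vanX by (simp add: S_def power2_eq_square)
  also have "\<dots> = (\<Sum>q<M. w $ q * (w $ q - X T (pt q) $ ix q))"
    by (simp add: sum_subtractf right_diff_distrib)
  also have "\<dots> \<le> (\<Sum>q<M. \<bar>w $ q\<bar> * (c * \<epsilon>))"
  proof (rule sum_mono)
    fix q assume "q \<in> {..<M}"
    have "w $ q * (w $ q - X T (pt q) $ ix q) \<le> \<bar>w $ q\<bar> * \<bar>w $ q - X T (pt q) $ ix q\<bar>"
      unfolding abs_mult[symmetric] by (rule abs_ge_self)
    also have "\<dots> \<le> \<bar>w $ q\<bar> * (c * \<epsilon>)" using comp[OF \<open>q \<in> {..<M}\<close>] by (intro mult_left_mono) auto
    finally show "w $ q * (w $ q - X T (pt q) $ ix q) \<le> \<bar>w $ q\<bar> * (c * \<epsilon>)" .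
  qed
  also have "\<dots> = W * (c * \<epsilon>)" by (simp add: W_def sum_distrib_right)
  also have "\<dots> = S * (W / (W + 1))" using c(1) by (simp add: \<epsilon>_def)
  also have "\<dots> < S * 1" using S W by (intro mult_strict_left_mono) simp_all
  finally show False by simp
qed

end

text \<open>Both sides are compared through surjectivity of \<open>ctrb (pts \<eta>)\<close>. What
  remains is to show that a fibre of \<open>(d, e\<^sup>2)\<close> lies over the points of a single
  eigenvalue.\<close>

theorem mainTheorem2:
  fixes K :: "real set" and r l m n :: nat
    and lam \<alpha> \<omega> :: "nat \<Rightarrow> real \<Rightarrow> real"
    and b :: "nat \<Rightarrow> real \<Rightarrow> real vec"
    and A Aadj B :: "real \<Rightarrow> real mat"
    and N :: "real vec \<Rightarrow> real"
    and pts :: "complex \<Rightarrow> real list"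
  defines "A \<equiv> sys_mat r l lam \<alpha> \<omega>"
    and "Aadj \<equiv> sys_mat_adj r l lam \<alpha> \<omega>"
    and "B \<equiv> input_mat n m b"
  assumes "compact K"
    and "m \<ge> 1" and "n = r + 2 * l" and "n \<ge> 1"
    and "\<And>j. j < r \<Longrightarrow> continuous_on K (lam j)"
    and "\<And>j. j < l \<Longrightarrow> continuous_on K (\<alpha> j)"
    and "\<And>j. j < l \<Longrightarrow> continuous_on K (\<omega> j)"
    and "\<And>j. j < r \<Longrightarrow> finite_to_one_on K (lam j)"
    and "\<And>j. j < l \<Longrightarrow> finite_to_one_on K (\<lambda>\<beta>. Complex (\<alpha> j \<beta>) (\<omega> j \<beta>))"
    and "\<And>j. j < l \<Longrightarrow> finite_to_one_on K (\<lambda>\<beta>. Complex (\<alpha> j \<beta>) (- \<omega> j \<beta>))"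
    and "\<And>j. j < m \<Longrightarrow> b j \<in> cont_vec_fun K n"
    and "\<And>f. f \<in> control_span K n m A b \<Longrightarrow> (\<lambda>\<beta>. Aadj \<beta> *\<^sub>v f \<beta>) \<in> control_span K n m A b"
    and "vec_norm_on n N"
    and "\<And>\<eta>. \<eta> \<in> eigenvalue_set K r l lam \<alpha> \<omega> \<Longrightarrow>
           distinct (pts \<eta>) \<and> set (pts \<eta>) = eigenvalue_fiber K r l lam \<alpha> \<omega> \<eta>"
  shows "uniformly_ensemble_controllable N K n m A b \<longleftrightarrow>
         (\<forall>\<eta>\<in>eigenvalue_set K r l lam \<alpha> \<omega>.
            vec_space.rank (n * card (eigenvalue_fiber K r l lam \<alpha> \<omega> \<eta>))
                (ensemble_controllability_matrix n m A B (pts \<eta>))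
              = n * card (eigenvalue_fiber K r l lam \<alpha> \<omega> \<eta>))"
proof -
  have n: "n > 0" using \<open>n \<ge> 1\<close> by simp
  interpret block_ensemble K n m A b "diag_entry r lam \<alpha>" "off_entry r \<omega>" "partner r"
  proof
    show "A \<beta> \<in> carrier_mat n n" for \<beta>
      unfolding A_def \<open>n = r + 2 * l\<close> by (rule sys_mat_carrier)
    show "(A \<beta> *\<^sub>v v) $ i = diag_entry r lam \<alpha> i \<beta> * v $ i + off_entry r \<omega> i \<beta> * v $ partner r i"
      if "v \<in> carrier_vec n" "i < n" for \<beta> v i
      using that unfolding A_def \<open>n = r + 2 * l\<close> by (rule sys_mat_mult_vec_index)
    show "continuous_on K (diag_entry r lam \<alpha> i)" if "i < n" for i
      using that \<open>n = r + 2 * l\<close>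
        \<open>\<And>j. j < r \<Longrightarrow> continuous_on K (lam j)\<close> \<open>\<And>j. j < l \<Longrightarrow> continuous_on K (\<alpha> j)\<close>
      by (cases i r rule: index_cases) simp_all
    show "continuous_on K (off_entry r \<omega> i)" if "i < n" for i
      using that \<open>n = r + 2 * l\<close> \<open>\<And>j. j < l \<Longrightarrow> continuous_on K (\<omega> j)\<close>
      by (cases i r rule: index_cases) (simp_all add: continuous_on_minus cong: continuous_on_cong)
    show "partner r i < n" if "i < n" for i
      using that unfolding \<open>n = r + 2 * l\<close> by (rule partner_less)
  qed (fact \<open>compact K\<close> partner_partner diag_entry_partner off_entry_partner
        \<open>\<And>j. j < m \<Longrightarrow> b j \<in> cont_vec_fun K n\<close>)+
  let ?eig = "eigenvalue_set K r l lam \<alpha> \<omega>" and ?fib = "eigenvalue_fiber K r l lam \<alpha> \<omega>"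
  have pts: "distinct (pts \<eta>)" "set (pts \<eta>) = ?fib \<eta>" "set (pts \<eta>) \<subseteq> K" "card (?fib \<eta>) = length (pts \<eta>)"
    if "\<eta> \<in> ?eig" for \<eta>
  proof -
    have *: "distinct (pts \<eta>) \<and> set (pts \<eta>) = ?fib \<eta>" using that by (rule assms)
    then show "distinct (pts \<eta>)" "set (pts \<eta>) = ?fib \<eta>" by simp_all
    then show "card (?fib \<eta>) = length (pts \<eta>)" by (metis distinct_card)
    show "set (pts \<eta>) \<subseteq> K" using * by (auto simp: eigenvalue_fiber_def)
  qed
  have rank_iff: "vec_space.rank (n * card (?fib \<eta>)) (ctrb (pts \<eta>)) = n * card (?fib \<eta>) \<longleftrightarrow>
      (\<forall>v\<in>carrier_vec (n * length (pts \<eta>)). \<exists>x\<in>carrier_vec (m * n * length (pts \<eta>)). ctrb (pts \<eta>) *\<^sub>v x = v)"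
    if "\<eta> \<in> ?eig" for \<eta>
    unfolding pts(4)[OF that]
    by (rule rank_eq_nrows_iff_surj) (simp add: ensemble_controllability_matrix_def)
  show ?thesis
    unfolding B_def
  proof
    assume "uniformly_ensemble_controllable N K n m A b"
    then show "\<forall>\<eta>\<in>?eig. vec_space.rank (n * card (?fib \<eta>)) (ctrb (pts \<eta>)) = n * card (?fib \<eta>)"
      using ctrb_surj_if_controllable[OF _ \<open>vec_norm_on n N\<close> _ _ n] pts rank_iff by simp
  next
    assume rank: "\<forall>\<eta>\<in>?eig. vec_space.rank (n * card (?fib \<eta>)) (ctrb (pts \<eta>)) = n * card (?fib \<eta>)"
    have fibre: "\<exists>f\<in>\<L>. \<forall>i<n. \<forall>\<beta>\<in>K. (diag_entry r lam \<alpha> i \<beta>, (off_entry r \<omega> i \<beta>)\<^sup>2) = y \<longrightarrow> f \<beta> $ i = h i \<beta>"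
      for y and h :: "nat \<Rightarrow> real \<Rightarrow> real"
    proof (cases "\<exists>i<n. \<exists>\<beta>\<in>K. (diag_entry r lam \<alpha> i \<beta>, (off_entry r \<omega> i \<beta>)\<^sup>2) = y")
      case False
      then show ?thesis
        using fun_span_zero[of n K] unfolding control_span_def by blast
    next
      case True
      then obtain i0 \<beta>0 where i0: "i0 < n" "\<beta>0 \<in> K"
        "y = (diag_entry r lam \<alpha> i0 \<beta>0, (off_entry r \<omega> i0 \<beta>0)\<^sup>2)" by blast
      \<comment> \<open>The conjugate of \<open>rate i0 \<beta>0\<close>; the sign is immaterial,
        since an eigenvalue and its conjugate have the same fibre.\<close>
      define \<eta> where "\<eta> = Complex (diag_entry r lam \<alpha> i0 \<beta>0) (off_entry r \<omega> i0 \<beta>0)"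
      have \<eta>: "\<eta> \<in> ?eig"
        using i0(1,2) \<open>n = r + 2 * l\<close>
        by (cases i0 r rule: index_cases)
           (auto simp: \<eta>_def eigenvalue_set_def complex_of_real_def)
      have in_fib: "\<beta> \<in> ?fib \<eta>"
        if "i < n" "\<beta> \<in> K" "(diag_entry r lam \<alpha> i \<beta>, (off_entry r \<omega> i \<beta>)\<^sup>2) = y" for i \<beta>
      proof -
        \<comment> \<open>Equality of squares loses the sign of the off-diagonal entry.
          \<open>eigenvalue_fiber\<close> takes preimages under both conjugate eigenvalue functions
          of a block, so either sign leads into it.\<close>
        have "diag_entry r lam \<alpha> i \<beta> = Re \<eta>" and off: "off_entry r \<omega> i \<beta> = Im \<eta> \<or> off_entry r \<omega> i \<beta> = - Im \<eta>"
          using that(3) by (simp_all add: \<eta>_def i0(3) power2_eq_iff)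
        then show ?thesis
          using that(1,2) \<open>n = r + 2 * l\<close>
          by (cases i r rule: index_cases)
             (auto simp: eigenvalue_fiber_def complex_eq_iff)
      qed
      \<comment> \<open>The rank condition prescribes all \<open>n\<close> coordinates at every
        point of the fibre; those whose own eigenvalue matches \<open>y\<close> are the ones
        used.\<close>
      obtain f where f: "f \<in> \<L>" "\<forall>p<length (pts \<eta>). \<forall>i<n. f (pts \<eta> ! p) $ i = h i (pts \<eta> ! p)"
        using interpolation_if_ctrb_surj[OF pts(3)[OF \<eta>] n] rank rank_iff[OF \<eta>] \<eta> by blast
      have "f \<beta> $ i = h i \<beta>"
        if "i < n" "\<beta> \<in> K" "(diag_entry r lam \<alpha> i \<beta>, (off_entry r \<omega> i \<beta>)\<^sup>2) = y" for i \<beta>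
        using in_fib[OF that] f(2) that(1) unfolding pts(2)[OF \<eta>, symmetric] in_set_conv_nth by blast
      then show ?thesis using f(1) by blast
    qed
    have Aadj_carrier: "Aadj \<beta> \<in> carrier_mat n n" for \<beta>
      unfolding Aadj_def sys_mat_adj_eq \<open>n = r + 2 * l\<close> by (rule sys_mat_carrier)
    have Aadj_index: "(Aadj \<beta> *\<^sub>v v) $ i = diag_entry r lam \<alpha> i \<beta> * v $ i - off_entry r \<omega> i \<beta> * v $ partner r i"
      if "v \<in> carrier_vec n" "i < n" for \<beta> v i
      using sys_mat_mult_vec_index[of v r l i lam \<alpha> "\<lambda>j \<beta>. - \<omega> j \<beta>" \<beta>] that
      unfolding Aadj_def sys_mat_adj_eq \<open>n = r + 2 * l\<close> off_entry_uminus by simp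
    have inv: "(\<lambda>\<beta>. Aadj \<beta> *\<^sub>v f \<beta>) \<in> \<L>" if "f \<in> \<L>" for f
      using that by (rule assms)
    show "uniformly_ensemble_controllable N K n m A b"
      by (rule controllable_if_dense[OF control_span_dense[OF Aadj_carrier Aadj_index inv fibre] \<open>vec_norm_on n N\<close>])
  qed
qed

end
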